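(* Let $X$ be a two-sided shift space on a finite alphabet $A$ with language $\mathcal L$, and $\varphi\colon X\to\mathbb R$ a continuous potential. Then given any $x\in X$ and $w\in\mathcal L_n$ ($n\ge1$) with $W^{\mathrm u}_{\mathrm{loc}}(x)\cap[w]^+\neq\emptyset$, we have $$\frac{\sum_{a\in A}\overline Q^+_{x.wa}}{e^{V^+_x(w)}\,\overline Q}\le\frac{m^{\mathrm u}_x([w]^+)}{e^{\Phi^+_x(w)-nP}}\le\sum_{a\in A}\underline Q^+_{x.wa}.$$ An analogous bound holds for $m^{\mathrm s}_x([w]^-)$: for $x\in X$ and $w\in\mathcal L_n$ with $W^{\mathrm s}_{\mathrm{loc}}(x)\cap[w]^-\ne\emptyset$, $$\frac{\sum_{a\in A}\overline Q^-_{aw.x}}{e^{V^-_x(w)}\,\overline Q}\le\frac{m^{\mathrm s}_x([w]^-)}{e^{\Phi^-_x(w)-nP}}\le\sum_{a\in A}\underline Q^-_{aw.x}.$$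
   Context: Let $A$ be a finite set and $\sigma\colon A^{\mathbb Z}\to A^{\mathbb Z}$ the shift $(\sigma x)_n=x_{n+1}$; $A^{\mathbb Z}$ has the metric $d(x,y)=2^{-\min\{|n|:x_n\ne y_n\}}$. A two-sided shift space is a (nonempty) closed $\sigma$-invariant set $X\subset A^{\mathbb Z}$. For $w\in A^n$ (length $|w|=n$) let $[w]^+=\{x\in X:x_{[0,n)}=w\}$ and $[w]^-=\{x\in X:x_{(-n,0]}=w\}$; $\mathcal L_n=\{w\in A^n:[w]^+\ne\emptyset\}$, $\mathcal L=\bigcup_{n\ge0}\mathcal L_n$, $\mathcal L_{\ge N}=\{w\in\mathcal L:|w|\ge N\}$. With $S_n\varphi(x)=\sum_{k=0}^{n-1}\varphi(\sigma^kx)$, put $\Phi(w)=\sup_{x\in[w]^+}S_{|w|}\varphi(x)$, $\Lambda_n=\sum_{w\in\mathcal L_n}e^{\Phi(w)}$, $P=\lim_n\frac1n\log\Lambda_n$, $\overline Q=\varlimsup_{n\to\infty}\Lambda_ne^{-nP}$. Quotients with denominator involving $\overline Q=\infty$ are interpreted as $0$. Leaves: $W^{\mathrm u}_{\mathrm{loc}}(x)=\{y\in X:y_k=x_k\ \forall k\le0\}$, $W^{\mathrm s}_{\mathrm{loc}}(x)=\{y\in X:y_k=x_k\ \forall k\ge0\}$. Weights: $\Phi^+_x(w)=\sup\{S_{|w|}\varphi(y):y\in W^{\mathrm u}_{\mathrm{loc}}(x)\cap[w]^+\}$, $\Phi^-_x(w)=\sup\{\sum_{k=0}^{|w|-1}\varphi(\sigma^{-k}y):y\in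 W^{\mathrm s}_{\mathrm{loc}}(x)\cap[w]^-\}$ ($\sup\emptyset=-\infty$, $e^{-\infty}=0$). Covers: $\mathbb E^{\pm}(Z,N)=\{\mathcal E\subset\mathcal L_{\ge N}:Z\subset\bigcup_{w\in\mathcal E}[w]^{\pm}\}$. Leaf measures (Borel measures on the leaves): $m^{\mathrm u}_x(Z)=\lim_{N\to\infty}\inf\{\sum_{w\in\mathcal E}e^{\Phi^+_x(w)-|w|P}:\mathcal E\in\mathbb E^+(Z,N)\}$ for $Z\subset W^{\mathrm u}_{\mathrm{loc}}(x)$, and $m^{\mathrm s}_x(Z)=\lim_{N\to\infty}\inf\{\sum_{w\in\mathcal E}e^{\Phi^-_x(w)-|w|P}:\mathcal E\in\mathbb E^-(Z,N)\}$ for $Z\subset W^{\mathrm s}_{\mathrm{loc}}(x)$. Here $m^{\mathrm u}_x([w]^+)$ means $m^{\mathrm u}_x(W^{\mathrm u}_{\mathrm{loc}}(x)\cap[w]^+)$, and similarly for $m^{\mathrm s}_x([w]^-)$. Variations: $V^+_x(w)=\sup\{|S_{|w|}\varphi(y)-S_{|w|}\varphi(z)|:y,z\in W^{\mathrm u}_{\mathrm{loc}}(x)\cap[w]^+\}$ and $V^-_x(w)=\sup\{|\sum_{k=0}^{|w|-1}(\varphi(\sigma^{-k}y)-\varphi(\sigma^{-k}z))|:y,z\in W^{\mathrm s}_{\mathrm{loc}}(x)\cap[w]^-\}$. Leaf partition sums: $\Lambda^{\pm}_n(x)=\sum_{u\in\mathcal L_n}e^{\Phi^{\pm}_x(u)}$,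 $\overline Q^{\pm}_x=\varlimsup_n\Lambda^{\pm}_n(x)e^{-nP}$, $\underline Q^{\pm}_x=\varliminf_n\Lambda^{\pm}_n(x)e^{-nP}$. The quantities with $+$ depend only on $x_{(-\infty,0]}$ and those with $-$ only on $x_{[0,\infty)}$, so they make sense for one-sided sequences (extend to any point of $X$). Concatenation: if $w_1=x_0$, $x.wa$ is the left-infinite sequence $\cdots x_{-2}x_{-1}w_1\cdots w_na$ indexed by $(-\infty,0]\cap\mathbb Z$ with $a$ at position $0$. If $w_n=x_0$, $aw.x$ is the right-infinite sequence $aw_1\cdots w_nx_1x_2\cdots$ indexed by $[0,\infty)\cap\mathbb Z$ with $a$ at position $0$. If such a sequence does not extend to a point of $X$, the corresponding $\overline Q^{\pm}$ and $\underline Q^{\pm}$ are $0$. *)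

theory Defs
  imports "HOL-Analysis.Analysis"
begin

section \<open>Two-sided shift spaces\<close>

definition shift :: "(int \<Rightarrow> 'a) \<Rightarrow> (int \<Rightarrow> 'a)" where
  "shift x = (\<lambda>n. x (n + 1))"

definition shift_dist :: "(int \<Rightarrow> 'a) \<Rightarrow> (int \<Rightarrow> 'a) \<Rightarrow> real" where
  "shift_dist x y =
     (if x = y then 0 else 2 powr - real (LEAST m. \<exists>n. m = nat \<bar>n\<bar> \<and> x n \<noteq> y n))"

text \<open>Invariance is the equality \<open>\<sigma> X = X\<close>, so that negative iterates of the shift act on \<open>X\<close>.\<close>

definition two_sided_shift_space :: "'a set \<Rightarrow> (int \<Rightarrow> 'a) set \<Rightarrow> bool" where
  "two_sided_shift_space A X \<longleftrightarrow>
     X \<noteq> {} \<and> closedin (Metric_space.mtopology (UNIV \<rightarrow> A) shift_dist) X \<and> shift ` X = X"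

definition continuous_potential :: "(int \<Rightarrow> 'a) set \<Rightarrow> ((int \<Rightarrow> 'a) \<Rightarrow> real) \<Rightarrow> bool" where
  "continuous_potential X \<phi> \<longleftrightarrow>
     continuous_map (Metric_space.mtopology X shift_dist) euclideanreal \<phi>"

lemma shift_dist_ge:
  assumes "x n \<noteq> y n"
  shows "2 powr - real (nat \<bar>n\<bar>) \<le> shift_dist x y"
proof -
  have "(LEAST m. \<exists>n. m = nat \<bar>n\<bar> \<and> x n \<noteq> y n) \<le> nat \<bar>n\<bar>"
    by (rule Least_le) (use assms in blast)
  moreover have "x \<noteq> y" using assms by blast
  ultimately show ?thesis unfolding shift_dist_def by simp
qed

lemma shift_dist_attained:
  assumes "x \<noteq> y"
  obtains n where "x n \<noteq> y n" "shift_dist x y = 2 powr - real (nat \<bar>n\<bar>)"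
proof -
  let ?P = "\<lambda>m. \<exists>n. m = nat \<bar>n\<bar> \<and> x n \<noteq> y n"
  have "\<exists>m. ?P m" using assms by (auto simp: fun_eq_iff)
  then have "?P (LEAST m. ?P m)" by (rule LeastI_ex)
  then obtain n where n: "(LEAST m. ?P m) = nat \<bar>n\<bar>" "x n \<noteq> y n" by blast
  have "shift_dist x y = 2 powr - real (nat \<bar>n\<bar>)"
    unfolding shift_dist_def n(1) using assms by (rule if_not_P)
  with n(2) show ?thesis by (rule that)
qed

text \<open>\<open>Metric_space.mtopology\<close> above is meaningful because \<open>shift_dist\<close> is a metric.\<close>

lemma Metric_space_shift_dist: "Metric_space M shift_dist"
proof
  fix x y z :: "int \<Rightarrow> 'a"
  show nonneg: "0 \<le> shift_dist x y" for x y :: "int \<Rightarrow> 'a"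
    by (simp add: shift_dist_def)
  have "(x = y) = (y = x)" "\<And>n. (x n \<noteq> y n) = (y n \<noteq> x n)"
    by auto
  then show "shift_dist x y = shift_dist y x"
    by (simp only: shift_dist_def)
  show "(shift_dist x y = 0) = (x = y)"
    by (simp add: shift_dist_def)
  show "shift_dist x z \<le> shift_dist x y + shift_dist y z"
  proof (cases "x = z")
    case True
    then show ?thesis using nonneg by (simp add: shift_dist_def)
  next
    case False
    then obtain n where n: "x n \<noteq> z n" "shift_dist x z = 2 powr - real (nat \<bar>n\<bar>)"
      by (rule shift_dist_attained)
    have "x n \<noteq> y n \<or> y n \<noteq> z n" using n(1) by metis
    then show ?thesis
      using shift_dist_ge[of x n y] shift_dist_ge[of y n z] nonneg[of x y] nonneg[of y z] n(2)
      by linarith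
  qed
qed

section \<open>Language, pressure\<close>

text \<open>Words are lists: the letters \<open>w\<^sub>1, \<dots>, w\<^sub>n\<close> are \<open>w ! 0, \<dots>, w ! (n - 1)\<close>.\<close>

definition cyl_fwd :: "(int \<Rightarrow> 'a) set \<Rightarrow> 'a list \<Rightarrow> (int \<Rightarrow> 'a) set" where
  "cyl_fwd X w = {x \<in> X. \<forall>i<length w. x (int i) = w ! i}"

definition cyl_bwd :: "(int \<Rightarrow> 'a) set \<Rightarrow> 'a list \<Rightarrow> (int \<Rightarrow> 'a) set" where
  "cyl_bwd X w = {x \<in> X. \<forall>i<length w. x (int i - int (length w) + 1) = w ! i}"

text \<open>For \<open>X \<subseteq> (UNIV \<rightarrow> A)\<close>, the letters of a word with nonempty cylinder lie in \<open>A\<close>.\<close>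

definition lang :: "(int \<Rightarrow> 'a) set \<Rightarrow> nat \<Rightarrow> 'a list set" where
  "lang X n = {w. length w = n \<and> cyl_fwd X w \<noteq> {}}"

definition lang_ge :: "(int \<Rightarrow> 'a) set \<Rightarrow> nat \<Rightarrow> 'a list set" where
  "lang_ge X N = (\<Union>n\<in>{N..}. lang X n)"

definition birkhoff :: "((int \<Rightarrow> 'a) \<Rightarrow> real) \<Rightarrow> nat \<Rightarrow> (int \<Rightarrow> 'a) \<Rightarrow> real" where
  "birkhoff \<phi> n x = (\<Sum>k<n. \<phi> ((shift ^^ k) x))"

definition birkhoff_bwd :: "((int \<Rightarrow> 'a) \<Rightarrow> real) \<Rightarrow> nat \<Rightarrow> (int \<Rightarrow> 'a) \<Rightarrow> real" where
  "birkhoff_bwd \<phi> n x = (\<Sum>k<n. \<phi> ((inv shift ^^ k) x))"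

definition word_sup :: "(int \<Rightarrow> 'a) set \<Rightarrow> ((int \<Rightarrow> 'a) \<Rightarrow> real) \<Rightarrow> 'a list \<Rightarrow> real" where
  "word_sup X \<phi> w = (SUP x\<in>cyl_fwd X w. birkhoff \<phi> (length w) x)"

definition partition_sum :: "(int \<Rightarrow> 'a) set \<Rightarrow> ((int \<Rightarrow> 'a) \<Rightarrow> real) \<Rightarrow> nat \<Rightarrow> real" where
  "partition_sum X \<phi> n = (\<Sum>w\<in>lang X n. exp (word_sup X \<phi> w))"

definition pressure :: "(int \<Rightarrow> 'a) set \<Rightarrow> ((int \<Rightarrow> 'a) \<Rightarrow> real) \<Rightarrow> real" where
  "pressure X \<phi> = lim (\<lambda>n. ln (partition_sum X \<phi> n) / real n)"

text \<open>
  \<open>Q_upper\<close> may be infinite. Division in \<open>ennreal\<close> satisfies \<open>t / \<infinity> = 0\<close> for every \<open>t\<close>, including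
  \<open>t = \<infinity>\<close>, so quotients with denominator \<open>\<dots> * Q_upper X \<phi> = \<infinity>\<close> are \<open>0\<close>, as intended.
\<close>

definition Q_upper :: "(int \<Rightarrow> 'a) set \<Rightarrow> ((int \<Rightarrow> 'a) \<Rightarrow> real) \<Rightarrow> ennreal" where
  "Q_upper X \<phi> =
     limsup (\<lambda>n. ennreal (partition_sum X \<phi> n * exp (- (real n * pressure X \<phi>))))"

section \<open>Leaves, leaf weights and leaf measures\<close>

text \<open>
  In \<open>Wu X x\<close> only the coordinates \<open>x k\<close> with \<open>k \<le> 0\<close> matter, and in \<open>Ws X x\<close> only those
  with \<open>k \<ge> 0\<close>. So \<open>x\<close> may also be a one-sided sequence, padded arbitrarily; the leaf is
  then the set of points of \<open>X\<close> that extend it.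
\<close>

definition Wu :: "(int \<Rightarrow> 'a) set \<Rightarrow> (int \<Rightarrow> 'a) \<Rightarrow> (int \<Rightarrow> 'a) set" where
  "Wu X x = {y \<in> X. \<forall>k\<le>0. y k = x k}"

definition Ws :: "(int \<Rightarrow> 'a) set \<Rightarrow> (int \<Rightarrow> 'a) \<Rightarrow> (int \<Rightarrow> 'a) set" where
  "Ws X x = {y \<in> X. \<forall>k\<ge>0. y k = x k}"

definition exp_ereal :: "ereal \<Rightarrow> ennreal" where
  "exp_ereal t = (case t of ereal r \<Rightarrow> ennreal (exp r) | PInfty \<Rightarrow> \<infinity> | MInfty \<Rightarrow> 0)"

definition Phi_u ::
  "(int \<Rightarrow> 'a) set \<Rightarrow> ((int \<Rightarrow> 'a) \<Rightarrow> real) \<Rightarrow> (int \<Rightarrow> 'a) \<Rightarrow> 'a list \<Rightarrow> ereal" where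
  "Phi_u X \<phi> x w = (SUP y\<in>Wu X x \<inter> cyl_fwd X w. ereal (birkhoff \<phi> (length w) y))"

definition Phi_s ::
  "(int \<Rightarrow> 'a) set \<Rightarrow> ((int \<Rightarrow> 'a) \<Rightarrow> real) \<Rightarrow> (int \<Rightarrow> 'a) \<Rightarrow> 'a list \<Rightarrow> ereal" where
  "Phi_s X \<phi> x w = (SUP y\<in>Ws X x \<inter> cyl_bwd X w. ereal (birkhoff_bwd \<phi> (length w) y))"

definition covers_u :: "(int \<Rightarrow> 'a) set \<Rightarrow> (int \<Rightarrow> 'a) set \<Rightarrow> nat \<Rightarrow> 'a list set set" where
  "covers_u X Z N = {E. E \<subseteq> lang_ge X N \<and> Z \<subseteq> (\<Union>w\<in>E. cyl_fwd X w)}"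

definition covers_s :: "(int \<Rightarrow> 'a) set \<Rightarrow> (int \<Rightarrow> 'a) set \<Rightarrow> nat \<Rightarrow> 'a list set set" where
  "covers_s X Z N = {E. E \<subseteq> lang_ge X N \<and> Z \<subseteq> (\<Union>w\<in>E. cyl_bwd X w)}"

definition m_u ::
  "(int \<Rightarrow> 'a) set \<Rightarrow> ((int \<Rightarrow> 'a) \<Rightarrow> real) \<Rightarrow> (int \<Rightarrow> 'a) \<Rightarrow> (int \<Rightarrow> 'a) set \<Rightarrow> ennreal" where
  "m_u X \<phi> x Z = lim (\<lambda>N. INF E\<in>covers_u X Z N.
     (\<Sum>\<^sub>\<infinity>w\<in>E. exp_ereal (Phi_u X \<phi> x w - ereal (real (length w) * pressure X \<phi>))))"

definition m_s ::
  "(int \<Rightarrow> 'a) set \<Rightarrow> ((int \<Rightarrow> 'a) \<Rightarrow> real) \<Rightarrow> (int \<Rightarrow> 'a) \<Rightarrow> (int \<Rightarrow> 'a) set \<Rightarrow> ennreal" where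
  "m_s X \<phi> x Z = lim (\<lambda>N. INF E\<in>covers_s X Z N.
     (\<Sum>\<^sub>\<infinity>w\<in>E. exp_ereal (Phi_s X \<phi> x w - ereal (real (length w) * pressure X \<phi>))))"

definition V_u ::
  "(int \<Rightarrow> 'a) set \<Rightarrow> ((int \<Rightarrow> 'a) \<Rightarrow> real) \<Rightarrow> (int \<Rightarrow> 'a) \<Rightarrow> 'a list \<Rightarrow> ereal" where
  "V_u X \<phi> x w =
     (SUP (y, z)\<in>(Wu X x \<inter> cyl_fwd X w) \<times> (Wu X x \<inter> cyl_fwd X w).
        ereal \<bar>birkhoff \<phi> (length w) y - birkhoff \<phi> (length w) z\<bar>)"

definition V_s ::
  "(int \<Rightarrow> 'a) set \<Rightarrow> ((int \<Rightarrow> 'a) \<Rightarrow> real) \<Rightarrow> (int \<Rightarrow> 'a) \<Rightarrow> 'a list \<Rightarrow> ereal" where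
  "V_s X \<phi> x w =
     (SUP (y, z)\<in>(Ws X x \<inter> cyl_bwd X w) \<times> (Ws X x \<inter> cyl_bwd X w).
        ereal \<bar>birkhoff_bwd \<phi> (length w) y - birkhoff_bwd \<phi> (length w) z\<bar>)"

section \<open>Leaf partition sums\<close>

definition leaf_sum_u ::
  "(int \<Rightarrow> 'a) set \<Rightarrow> ((int \<Rightarrow> 'a) \<Rightarrow> real) \<Rightarrow> (int \<Rightarrow> 'a) \<Rightarrow> nat \<Rightarrow> ennreal" where
  "leaf_sum_u X \<phi> x n = (\<Sum>u\<in>lang X n. exp_ereal (Phi_u X \<phi> x u))"

definition leaf_sum_s ::
  "(int \<Rightarrow> 'a) set \<Rightarrow> ((int \<Rightarrow> 'a) \<Rightarrow> real) \<Rightarrow> (int \<Rightarrow> 'a) \<Rightarrow> nat \<Rightarrow> ennreal" where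
  "leaf_sum_s X \<phi> x n = (\<Sum>u\<in>lang X n. exp_ereal (Phi_s X \<phi> x u))"

definition Q_upper_u where
  "Q_upper_u X \<phi> x =
     limsup (\<lambda>n. leaf_sum_u X \<phi> x n * ennreal (exp (- (real n * pressure X \<phi>))))"

definition Q_lower_u where
  "Q_lower_u X \<phi> x =
     liminf (\<lambda>n. leaf_sum_u X \<phi> x n * ennreal (exp (- (real n * pressure X \<phi>))))"

definition Q_upper_s where
  "Q_upper_s X \<phi> x =
     limsup (\<lambda>n. leaf_sum_s X \<phi> x n * ennreal (exp (- (real n * pressure X \<phi>))))"

definition Q_lower_s where
  "Q_lower_s X \<phi> x =
     liminf (\<lambda>n. leaf_sum_s X \<phi> x n * ennreal (exp (- (real n * pressure X \<phi>))))"

text \<open>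
  The same quantities for one-sided sequences \<open>\<xi>\<close>: evaluate at any point of \<open>X\<close> extending
  \<open>\<xi>\<close> (the lemmas show that the choice is immaterial), and take \<open>0\<close> if there is none.
\<close>

definition at_ext_u ::
  "(int \<Rightarrow> 'a) set \<Rightarrow> ((int \<Rightarrow> 'a) \<Rightarrow> ennreal) \<Rightarrow> (int \<Rightarrow> 'a) \<Rightarrow> ennreal" where
  "at_ext_u X q \<xi> = (if Wu X \<xi> = {} then 0 else q (SOME z. z \<in> Wu X \<xi>))"

definition at_ext_s ::
  "(int \<Rightarrow> 'a) set \<Rightarrow> ((int \<Rightarrow> 'a) \<Rightarrow> ennreal) \<Rightarrow> (int \<Rightarrow> 'a) \<Rightarrow> ennreal" where
  "at_ext_s X q \<xi> = (if Ws X \<xi> = {} then 0 else q (SOME z. z \<in> Ws X \<xi>))"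

lemma Wu_eq: "z \<in> Wu X \<xi> \<Longrightarrow> Wu X z = Wu X \<xi>"
  by (auto simp: Wu_def)

lemma Ws_eq: "z \<in> Ws X \<xi> \<Longrightarrow> Ws X z = Ws X \<xi>"
  by (auto simp: Ws_def)

lemma at_ext_u_eq:
  assumes z: "z \<in> Wu X \<xi>"
  shows "at_ext_u X (Q_upper_u X \<phi>) \<xi> = Q_upper_u X \<phi> z"
    and "at_ext_u X (Q_lower_u X \<phi>) \<xi> = Q_lower_u X \<phi> z"
proof -
  have "Wu X (SOME z. z \<in> Wu X \<xi>) = Wu X z"
    using Wu_eq[OF z] Wu_eq[OF someI[of "\<lambda>z. z \<in> Wu X \<xi>", OF z]] by simp
  then show "at_ext_u X (Q_upper_u X \<phi>) \<xi> = Q_upper_u X \<phi> z"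
    and "at_ext_u X (Q_lower_u X \<phi>) \<xi> = Q_lower_u X \<phi> z"
    using z by (auto simp: at_ext_u_def Q_upper_u_def Q_lower_u_def leaf_sum_u_def Phi_u_def)
qed

lemma at_ext_s_eq:
  assumes z: "z \<in> Ws X \<xi>"
  shows "at_ext_s X (Q_upper_s X \<phi>) \<xi> = Q_upper_s X \<phi> z"
    and "at_ext_s X (Q_lower_s X \<phi>) \<xi> = Q_lower_s X \<phi> z"
proof -
  have "Ws X (SOME z. z \<in> Ws X \<xi>) = Ws X z"
    using Ws_eq[OF z] Ws_eq[OF someI[of "\<lambda>z. z \<in> Ws X \<xi>", OF z]] by simp
  then show "at_ext_s X (Q_upper_s X \<phi>) \<xi> = Q_upper_s X \<phi> z"
    and "at_ext_s X (Q_lower_s X \<phi>) \<xi> = Q_lower_s X \<phi> z"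
    using z by (auto simp: at_ext_s_def Q_upper_s_def Q_lower_s_def leaf_sum_s_def Phi_s_def)
qed

text \<open>
  \<open>concat_u x w a\<close> is the left-infinite sequence \<open>x.wa\<close>, i.e. \<open>\<dots> x\<^sub>-\<^sub>2 x\<^sub>-\<^sub>1 w\<^sub>1 \<dots> w\<^sub>n a\<close> with \<open>a\<close> at
  position \<open>0\<close>; \<open>concat_s a w x\<close> is the right-infinite sequence \<open>aw.x\<close>, i.e.
  \<open>a w\<^sub>1 \<dots> w\<^sub>n x\<^sub>1 x\<^sub>2 \<dots>\<close> with \<open>a\<close> at position \<open>0\<close>.
\<close>

definition concat_u :: "(int \<Rightarrow> 'a) \<Rightarrow> 'a list \<Rightarrow> 'a \<Rightarrow> (int \<Rightarrow> 'a)" where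
  "concat_u x w a = (\<lambda>k.
     if k > 0 then undefined
     else if k = 0 then a
     else if k \<ge> - int (length w) then w ! nat (k + int (length w))
     else x (k + int (length w)))"

definition concat_s :: "'a \<Rightarrow> 'a list \<Rightarrow> (int \<Rightarrow> 'a) \<Rightarrow> (int \<Rightarrow> 'a)" where
  "concat_s a w x = (\<lambda>k.
     if k < 0 then undefined
     else if k = 0 then a
     else if k \<le> int (length w) then w ! nat (k - 1)
     else x (k - int (length w)))"

end

theory Submission
  imports Defs
begin

text \<open>
  Weights along a leaf are almost multiplicative: splitting the Birkhoff sum over a word
  \<open>wv\<close> after \<open>w\<close> and applying \<open>\<sigma>\<^sup>n\<close> shows
  \<open>\<Phi>\<^sup>+\<^sub>x(wv) \<le> \<Phi>\<^sup>+\<^sub>x(w) + \<Phi>\<^sup>+\<^bsub>x.wa\<^esub>(v)\<close>, with an error of at most \<open>V\<^sup>+\<^sub>x(w)\<close> in the other direction,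
  where \<open>a\<close> is the first letter of \<open>v\<close>.

  Upper bound: cover the part of the cylinder with \<open>y\<^sub>n = a\<close> by all words \<open>wv\<close> with \<open>\<bar>v\<bar> = m\<^sub>a\<close>,
  where the lengths \<open>m\<^sub>a\<close> are chosen independently along sequences realising the lower limits.

  Lower bound: reduce a cover of the cylinder to a finite one by compactness. Stripping \<open>w\<close> from
  its words gives finite covers \<open>F\<^sub>a\<close> of the leaves of \<open>x.wa\<close>. Every long word that occurs in such a leaf
  starts with some \<open>v \<in> F\<^sub>a\<close>, so \<open>\<Lambda>\<^sup>+\<^sub>k\<close> is at most the sum over \<open>v\<close> of
  \<open>exp (\<Phi>\<^sup>+(v))\<close> times \<open>\<Lambda>\<^bsub>k-\<bar>v\<bar>\<^esub>\<close>; the limit superior in \<open>k\<close> bounds the cost of \<open>F\<^sub>a\<close> from below.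

  The stable bounds are the unstable ones for the reflected subshift, in which words are reversed;
  the partition sums, hence \<open>P\<close> and the global upper limit, are the same by shift invariance.
\<close>

section \<open>Preliminaries\<close>

lemma exp_ereal_mono: "s \<le> t \<Longrightarrow> exp_ereal s \<le> exp_ereal t"
  by (cases s; cases t) (auto simp: exp_ereal_def)

lemma exp_ereal_simps [simp]:
  "exp_ereal (ereal r) = ennreal (exp r)" "exp_ereal \<infinity> = \<infinity>" "exp_ereal (- \<infinity>) = 0"
  by (simp_all add: exp_ereal_def)

lemma exp_ereal_diff: "exp_ereal (t - ereal c) = exp_ereal t * ennreal (exp (- c))"
  by (cases t) (auto simp: exp_diff exp_minus divide_inverse ennreal_mult' ennreal_top_mult)

text \<open>A finite bound r on the exponentials gives the bound ln r on the exponents, and r is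
  positive as soon as D has a point. The empty D is consistent: its supremum is minus infinity, with
  exponential 0. Weights can thus be handled as suprema in \<open>ennreal\<close>.\<close>

lemma exp_ereal_SUP: "exp_ereal (SUP y\<in>D. ereal (f y)) = (SUP y\<in>D. ennreal (exp (f y)))"
proof (rule antisym)
  show "(SUP y\<in>D. ennreal (exp (f y))) \<le> exp_ereal (SUP y\<in>D. ereal (f y))"
    by (rule SUP_least) (metis SUP_upper exp_ereal_mono exp_ereal_simps(1))
  show "exp_ereal (SUP y\<in>D. ereal (f y)) \<le> (SUP y\<in>D. ennreal (exp (f y)))"
  proof (cases "D = {}")
    case True
    then show ?thesis by (simp add: bot_ereal_def)
  next
    case False
    then obtain d where d: "d \<in> D" by blast
    show ?thesis
    proof (cases "SUP y\<in>D. ennreal (exp (f y))" rule: ennreal_cases)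
      case (real r)
      have le: "exp (f y) \<le> r" if "y \<in> D" for y
      proof -
        have "ennreal (exp (f y)) \<le> (SUP y\<in>D. ennreal (exp (f y)))"
          using that by (rule SUP_upper)
        then show ?thesis using real by simp
      qed
      then have r: "r > 0" using d by (meson exp_gt_zero less_le_trans)
      have "(SUP y\<in>D. ereal (f y)) \<le> ereal (ln r)"
        using le r by (intro SUP_least) (simp add: ln_ge_iff)
      then have "exp_ereal (SUP y\<in>D. ereal (f y)) \<le> ennreal r"
        using exp_ereal_mono r by fastforce
      then show ?thesis using real by simp
    next
      case top
      show ?thesis unfolding top by simp
    qed
  qed
qed

text \<open>Cross-multiplication that survives degenerate d: if d = 0, the assumption forces a = 0,
  and if d is infinite, the left quotient is 0. This matches the convention for an infinite global
  upper limit.\<close>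

lemma ennreal_divide_le_divide:
  fixes a b c d :: ennreal
  assumes "a * c \<le> d * b" "c \<noteq> 0" "c \<noteq> top"
  shows "a / d \<le> b / c"
proof (cases "d = 0 \<or> d = top")
  case True
  then show ?thesis using assms by auto
next
  case False
  have "a = a * c / c" using assms by (simp add: ennreal_mult_divide_eq)
  also have "\<dots> \<le> d * b / c" using assms(1) by (rule divide_right_mono_ennreal)
  finally have "a \<le> d * (b / c)" by (simp add: ennreal_times_divide)
  then have "a / d \<le> d * (b / c) / d" by (rule divide_right_mono_ennreal)
  also have "\<dots> = b / c" using False by (metis ennreal_mult_divide_eq mult.commute)
  finally show ?thesis .
qed

section \<open>Iterated shifts, Birkhoff sums and cylinders of concatenated words\<close>

lemma funpow_shift: "(shift ^^ k) x = (\<lambda>i. x (i + int k))"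
  by (induction k) (auto simp: shift_def algebra_simps fun_eq_iff)

lemma inv_shift: "inv shift = (\<lambda>x i. x (i - 1))"
  by (rule inv_equality) (auto simp: shift_def)

lemma funpow_inv_shift: "(inv shift ^^ k) x = (\<lambda>i. x (i - int k))"
  by (induction k) (auto simp: inv_shift algebra_simps fun_eq_iff)

lemma birkhoff_add: "birkhoff \<phi> (m + n) y = birkhoff \<phi> m y + birkhoff \<phi> n ((shift ^^ m) y)"
  by (induction n) (simp_all add: birkhoff_def funpow_shift algebra_simps)

lemma cyl_fwd_append:
  assumes "(shift ^^ length v) ` X \<subseteq> X"
  shows "y \<in> cyl_fwd X (v @ u) \<longleftrightarrow> y \<in> cyl_fwd X v \<and> (shift ^^ length v) y \<in> cyl_fwd X u"
proof -
  have "(\<forall>i<length (v @ u). y (int i) = (v @ u) ! i) \<longleftrightarrow>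
      (\<forall>i<length v. y (int i) = v ! i) \<and> (\<forall>i<length u. y (int i + int (length v)) = u ! i)"
    (is "?L \<longleftrightarrow> ?R")
  proof
    assume L: ?L
    show ?R
    proof safe
      fix i assume "i < length v"
      then show "y (int i) = v ! i" using L[rule_format, of i] by (simp add: nth_append)
    next
      fix i assume "i < length u"
      then show "y (int i + int (length v)) = u ! i"
        using L[rule_format, of "i + length v"] by (simp add: nth_append)
    qed
  next
    assume R: ?R
    show ?L
    proof safe
      fix i assume i: "i < length (v @ u)"
      show "y (int i) = (v @ u) ! i"
      proof (cases "i < length v")
        case True
        then show ?thesis using R by (simp add: nth_append)
      next
        case False
        then obtain j where j: "i = length v + j" by (metis le_Suc_ex not_less)
        then have "y (int j + int (length v)) = u ! j" using R i by simp
        then show ?thesis using j by (simp add: nth_append add.commute)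
      qed
    qed
  qed
  then show ?thesis using assms by (auto simp: cyl_fwd_def funpow_shift image_subset_iff)
qed

text \<open>
  On an empty leaf all weights vanish, so the case distinction in \<open>at_ext_u\<close> is redundant.
\<close>

lemma at_ext_u_Q_upper: "at_ext_u X (Q_upper_u X \<phi>) \<xi> = Q_upper_u X \<phi> \<xi>"
proof (cases "Wu X \<xi> = {}")
  case True
  then show ?thesis
    by (simp add: at_ext_u_def Q_upper_u_def leaf_sum_u_def Phi_u_def bot_ereal_def Limsup_const)
next
  case False
  then obtain z where z: "z \<in> Wu X \<xi>" by blast
  then show ?thesis
    using at_ext_u_eq(1)[OF z] Wu_eq[OF z] by (simp add: Q_upper_u_def leaf_sum_u_def Phi_u_def)
qed

lemma at_ext_u_Q_lower: "at_ext_u X (Q_lower_u X \<phi>) \<xi> = Q_lower_u X \<phi> \<xi>"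
proof (cases "Wu X \<xi> = {}")
  case True
  then show ?thesis
    by (simp add: at_ext_u_def Q_lower_u_def leaf_sum_u_def Phi_u_def bot_ereal_def Liminf_const)
next
  case False
  then obtain z where z: "z \<in> Wu X \<xi>" by blast
  then show ?thesis
    using at_ext_u_eq(2)[OF z] Wu_eq[OF z] by (simp add: Q_lower_u_def leaf_sum_u_def Phi_u_def)
qed

lemma at_ext_s_Q_upper: "at_ext_s X (Q_upper_s X \<phi>) \<xi> = Q_upper_s X \<phi> \<xi>"
proof (cases "Ws X \<xi> = {}")
  case True
  then show ?thesis
    by (simp add: at_ext_s_def Q_upper_s_def leaf_sum_s_def Phi_s_def bot_ereal_def Limsup_const)
next
  case False
  then obtain z where z: "z \<in> Ws X \<xi>" by blast
  then show ?thesis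
    using at_ext_s_eq(1)[OF z] Ws_eq[OF z] by (simp add: Q_upper_s_def leaf_sum_s_def Phi_s_def)
qed

lemma at_ext_s_Q_lower: "at_ext_s X (Q_lower_s X \<phi>) \<xi> = Q_lower_s X \<phi> \<xi>"
proof (cases "Ws X \<xi> = {}")
  case True
  then show ?thesis
    by (simp add: at_ext_s_def Q_lower_s_def leaf_sum_s_def Phi_s_def bot_ereal_def Liminf_const)
next
  case False
  then obtain z where z: "z \<in> Ws X \<xi>" by blast
  then show ?thesis
    using at_ext_s_eq(2)[OF z] Ws_eq[OF z] by (simp add: Q_lower_s_def leaf_sum_s_def Phi_s_def)
qed

text \<open>Tail suprema of a decrease to its limsup, and multiplication by a finite c is
  continuous. Tail suprema appear in the hypothesis because b will be compared with several
  different index shifts of a at once.\<close>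

lemma limsup_le_mult_limsup:
  fixes a b :: "nat \<Rightarrow> ennreal" and c :: ennreal
  assumes "\<And>K. \<forall>\<^sub>F k in sequentially. b k \<le> c * (SUP i\<in>{K..}. a i)" and "c < top"
  shows "limsup b \<le> c * limsup a"
proof (rule LIMSEQ_le_const)
  have "antimono (\<lambda>K. SUP i\<in>{K..}. a i)"
    by (intro antimonoI SUP_subset_mono) auto
  then have "(\<lambda>K. SUP i\<in>{K..}. a i) \<longlonglongrightarrow> limsup a"
    unfolding limsup_INF_SUP by (rule LIMSEQ_INF)
  then show "(\<lambda>K. c * (SUP i\<in>{K..}. a i)) \<longlonglongrightarrow> c * limsup a"
    using assms(2) by (intro ennreal_tendsto_cmult) auto
  show "\<exists>N. \<forall>K\<ge>N. limsup b \<le> c * (SUP i\<in>{K..}. a i)"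
    using assms(1) by (auto intro: Limsup_bounded)
qed

text \<open>Letters carry the discrete topology, so U is arbitrary; passing to its complement shows
  that coordinate conditions are closed as well.\<close>

lemma openin_coordinate:
  "openin (product_topology (\<lambda>_. discrete_topology A) UNIV) {y. (\<forall>i. y i \<in> A) \<and> y k \<in> U}"
proof -
  have "openin (product_topology (\<lambda>_. discrete_topology A) UNIV)
      {y \<in> topspace (product_topology (\<lambda>_. discrete_topology A) UNIV). y k \<in> A \<inter> U}"
    by (rule openin_continuous_map_preimage[where Y = "discrete_topology A"])
      (auto intro: continuous_map_product_projection)
  also have "{y \<in> topspace (product_topology (\<lambda>_. discrete_topology A) UNIV). y k \<in> A \<inter> U} =
      {y. (\<forall>i. y i \<in> A) \<and> y k \<in> U}"
    by (auto simp: PiE_iff extensional_def)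
  finally show ?thesis .
qed

section \<open>Leaf weights of compact subshifts\<close>

text \<open>The metric is replaced by what the estimates use: compactness in the product topology
  and a bound on the potential. The reflected subshift satisfies the same conditions, so the
  unstable bounds can be instantiated a second time.\<close>

locale bounded_subshift =
  fixes A :: "'a set" and X :: "(int \<Rightarrow> 'a) set" and \<phi> :: "(int \<Rightarrow> 'a) \<Rightarrow> real" and B :: real
  assumes finite_alphabet: "finite A"
    and letter_in: "y \<in> X \<Longrightarrow> y i \<in> A"
    and compact: "compactin (product_topology (\<lambda>_. discrete_topology A) UNIV) X"
    and shift_image: "shift ` X = X"
    and bounded: "y \<in> X \<Longrightarrow> \<bar>\<phi> y\<bar> \<le> B"
begin

section \<open>Translations, words and Birkhoff bounds in a subshift\<close>

lemma funpow_shift_image: "(shift ^^ k) ` X = X"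
proof (induction k)
  case (Suc k)
  have "(shift ^^ Suc k) ` X = shift ` ((shift ^^ k) ` X)" by (simp add: image_comp)
  then show ?case using Suc shift_image by simp
qed simp

lemma funpow_shift_in: "y \<in> X \<Longrightarrow> (shift ^^ k) y \<in> X"
  using funpow_shift_image by blast

lemma translate_in:
  assumes "y \<in> X"
  shows "(\<lambda>i. y (i + k)) \<in> X"
proof (cases "k \<ge> 0")
  case True
  then show ?thesis using funpow_shift_in[OF assms, of "nat k"] by (simp add: funpow_shift)
next
  case False
  \<comment> \<open>For negative k the translate is a preimage under a power of the shift, which
    exists by surjectivity on X.\<close>
  obtain z where z: "z \<in> X" "y = (shift ^^ nat (- k)) z"
    using assms funpow_shift_image by (metis imageE)
  then have "(\<lambda>i. y (i + k)) = z" using False by (simp add: funpow_shift)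
  then show ?thesis using z by simp
qed

lemma mem_cyl_append:
  "y \<in> cyl_fwd X (v @ u) \<longleftrightarrow> y \<in> cyl_fwd X v \<and> (shift ^^ length v) y \<in> cyl_fwd X u"
  by (rule cyl_fwd_append) (simp add: funpow_shift_image)

lemma birkhoff_bound: "y \<in> X \<Longrightarrow> \<bar>birkhoff \<phi> n y\<bar> \<le> real n * B"
  unfolding birkhoff_def
  by (rule order_trans[OF sum_abs], rule order_trans[OF sum_bounded_above[where K = B]])
     (auto intro: bounded funpow_shift_in)

lemma birkhoff_le_word_sup:
  assumes "y \<in> cyl_fwd X u"
  shows "birkhoff \<phi> (length u) y \<le> word_sup X \<phi> u"
  unfolding word_sup_def
proof (rule cSUP_upper[OF assms])
  show "bdd_above ((\<lambda>y. birkhoff \<phi> (length u) y) ` cyl_fwd X u)"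
    using birkhoff_bound by (intro bdd_aboveI2[where M = "real (length u) * B"])
      (auto simp: cyl_fwd_def intro: abs_le_D1)
qed

lemma lang_letters: "u \<in> lang X n \<Longrightarrow> set u \<subseteq> A"
  unfolding lang_def cyl_fwd_def in_set_conv_nth subset_iff by clarsimp (metis letter_in)

lemma finite_lang: "finite (lang X n)"
proof (rule finite_subset)
  show "lang X n \<subseteq> {u. set u \<subseteq> A \<and> length u = n}"
    using lang_letters by (auto simp: lang_def)
  show "finite {u. set u \<subseteq> A \<and> length u = n}"
    using finite_alphabet by (rule finite_lists_length_eq)
qed

section \<open>Weights on a leaf and their behaviour under concatenation\<close>

definition leaf_weight :: "(int \<Rightarrow> 'a) \<Rightarrow> 'a list \<Rightarrow> ennreal" where
  "leaf_weight x u = exp_ereal (Phi_u X \<phi> x u)"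

lemma leaf_weight_eq:
  "leaf_weight x u = (SUP y\<in>Wu X x \<inter> cyl_fwd X u. ennreal (exp (birkhoff \<phi> (length u) y)))"
  unfolding leaf_weight_def Phi_u_def by (rule exp_ereal_SUP)

lemma leaf_weight_upper:
  "\<lbrakk>y \<in> Wu X x; y \<in> cyl_fwd X u\<rbrakk> \<Longrightarrow> ennreal (exp (birkhoff \<phi> (length u) y)) \<le> leaf_weight x u"
  unfolding leaf_weight_eq by (rule SUP_upper) simp

lemma leaf_weight_empty: "Wu X x \<inter> cyl_fwd X u = {} \<Longrightarrow> leaf_weight x u = 0"
  by (simp add: leaf_weight_eq bot_ennreal)

lemma leaf_weight_less_top: "leaf_weight x u < top"
proof -
  have "leaf_weight x u \<le> ennreal (exp (real (length u) * B))"
    unfolding leaf_weight_eq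
    using birkhoff_bound by (intro SUP_least) (auto simp: Wu_def intro: abs_le_D1)
  then show ?thesis using ennreal_less_top le_less_trans by blast
qed

lemma leaf_weight_pos:
  assumes "Wu X x \<inter> cyl_fwd X u \<noteq> {}"
  shows "leaf_weight x u \<noteq> 0"
proof -
  obtain y where "y \<in> Wu X x" "y \<in> cyl_fwd X u" using assms by blast
  then have "ennreal (exp (birkhoff \<phi> (length u) y)) \<le> leaf_weight x u"
    by (rule leaf_weight_upper)
  then show ?thesis by (metis ennreal_eq_0_iff exp_gt_zero le_zero_eq not_le)
qed

text \<open>After the Birkhoff sum is split behind v, the shifted point is controlled only by the
  whole cylinder of u, not by one leaf. This is how the global partition sums enter the lower
  bound.\<close>

lemma leaf_weight_append_le_word_sup:
  "leaf_weight x (v @ u) \<le> leaf_weight x v * ennreal (exp (word_sup X \<phi> u))"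
  unfolding leaf_weight_eq[of _ "v @ u"]
proof (rule SUP_least)
  fix y assume "y \<in> Wu X x \<inter> cyl_fwd X (v @ u)"
  then have y: "y \<in> Wu X x" "y \<in> cyl_fwd X v" "(shift ^^ length v) y \<in> cyl_fwd X u"
    by (simp_all add: mem_cyl_append)
  have "ennreal (exp (birkhoff \<phi> (length (v @ u)) y)) =
      ennreal (exp (birkhoff \<phi> (length v) y)) *
      ennreal (exp (birkhoff \<phi> (length u) ((shift ^^ length v) y)))"
    by (simp add: birkhoff_add exp_add ennreal_mult')
  also have "\<dots> \<le> leaf_weight x v * ennreal (exp (word_sup X \<phi> u))"
    using y birkhoff_le_word_sup by (intro mult_mono leaf_weight_upper) auto
  finally show "ennreal (exp (birkhoff \<phi> (length (v @ u)) y)) \<le>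
      leaf_weight x v * ennreal (exp (word_sup X \<phi> u))" .
qed

lemma lang_append_right: "v @ u \<in> lang X n \<Longrightarrow> u \<in> lang X (n - length v)"
  using mem_cyl_append by (fastforce simp: lang_def)

text \<open>Shifting by |w| moves coordinate 0 to position -|w|, where \<open>concat_u\<close> reads
  the first letter of w and not a letter of x. The assumption \<open>w ! 0 = x 0\<close> reconciles
  the two descriptions at this overlap.\<close>

lemma Wu_concat_iff:
  assumes "y \<in> X" "w \<noteq> []" "w ! 0 = x 0"
  shows "(shift ^^ length w) y \<in> Wu X (concat_u x w a) \<longleftrightarrow>
    y \<in> Wu X x \<and> y \<in> cyl_fwd X w \<and> y (int (length w)) = a"
    (is "?L \<longleftrightarrow> ?R")
proof
  assume L: ?L
  have eq: "y k = concat_u x w a (k - int (length w))" if "k \<le> int (length w)" for k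
    using L that unfolding Wu_def funpow_shift
    by (auto dest!: spec[where x = "k - int (length w)"])
  have "y k = x k" if "k \<le> 0" for k
    using eq[of k] that assms by (cases "k = 0") (auto simp: concat_u_def)
  moreover have "y (int i) = w ! i" if "i < length w" for i
    using eq[of "int i"] that by (auto simp: concat_u_def)
  moreover have "y (int (length w)) = a"
    using eq[of "int (length w)"] by (simp add: concat_u_def)
  ultimately show ?R using assms by (simp add: Wu_def cyl_fwd_def)
next
  assume R: ?R
  have "y (k + int (length w)) = concat_u x w a k" if "k \<le> 0" for k
  proof (cases "k < - int (length w)")
    case True
    then show ?thesis using R by (auto simp: concat_u_def Wu_def)
  next
    case False
    define j where "j = nat (k + int (length w))"
    have k: "k = int j - int (length w)" using False by (simp add: j_def)
    show ?thesis
    proof (cases "k = 0")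
      case True
      then show ?thesis using R by (simp add: concat_u_def)
    next
      case False
      then have "j < length w" using k that by linarith
      then show ?thesis using R False that k by (auto simp: concat_u_def cyl_fwd_def)
    qed
  qed
  then show ?L using assms funpow_shift_in[of y] by (auto simp: Wu_def funpow_shift)
qed

text \<open>The first letter of v determines which leaf the shifted point enters, and each of the
  two parts of the split Birkhoff sum is bounded by its own supremum.\<close>

lemma leaf_weight_append_le:
  assumes "w \<noteq> []" "w ! 0 = x 0" "v \<noteq> []"
  shows "leaf_weight x (w @ v) \<le> leaf_weight x w * leaf_weight (concat_u x w (hd v)) v"
  unfolding leaf_weight_eq[of _ "w @ v"]
proof (rule SUP_least)
  fix y assume "y \<in> Wu X x \<inter> cyl_fwd X (w @ v)"
  then have y: "y \<in> Wu X x" "y \<in> cyl_fwd X w" "(shift ^^ length w) y \<in> cyl_fwd X v"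
    by (simp_all add: mem_cyl_append)
  then have "y (int (length w)) = hd v"
    using assms by (auto simp: cyl_fwd_def funpow_shift hd_conv_nth)
  then have "(shift ^^ length w) y \<in> Wu X (concat_u x w (hd v))"
    using y assms by (subst Wu_concat_iff) (auto simp: Wu_def)
  then have "ennreal (exp (birkhoff \<phi> (length w) y)) *
      ennreal (exp (birkhoff \<phi> (length v) ((shift ^^ length w) y))) \<le>
      leaf_weight x w * leaf_weight (concat_u x w (hd v)) v"
    using y by (intro mult_mono leaf_weight_upper) auto
  then show "ennreal (exp (birkhoff \<phi> (length (w @ v)) y)) \<le>
      leaf_weight x w * leaf_weight (concat_u x w (hd v)) v"
    by (simp add: birkhoff_add exp_add ennreal_mult')
qed

text \<open>The two suprema on the left may come from unrelated points y and z'. Pulling z' back to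
  a point z in the cylinder of w and replacing y by z in the first Birkhoff sum costs at most the
  variation over w; then one point z serves the whole word.\<close>

lemma leaf_weight_mult_le:
  assumes "w \<noteq> []" "w ! 0 = x 0"
  shows "leaf_weight x w * leaf_weight (concat_u x w a) v
    \<le> exp_ereal (V_u X \<phi> x w) * leaf_weight x (w @ v)"
proof -
  let ?D = "Wu X x \<inter> cyl_fwd X w"
  have "ennreal (exp (birkhoff \<phi> (length w) y)) * ennreal (exp (birkhoff \<phi> (length v) z'))
      \<le> exp_ereal (V_u X \<phi> x w) * leaf_weight x (w @ v)"
    if y: "y \<in> ?D" and z': "z' \<in> Wu X (concat_u x w a) \<inter> cyl_fwd X v" for y z'
  proof -
    have "z' \<in> (shift ^^ length w) ` X" using z' funpow_shift_image by (simp add: Wu_def)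
    then obtain z where z: "z \<in> X" "z' = (shift ^^ length w) z" by blast
    then have zD: "z \<in> Wu X x" "z \<in> cyl_fwd X w" using z' Wu_concat_iff assms by blast+
    then have zD': "z \<in> cyl_fwd X (w @ v)" using z z' by (simp add: mem_cyl_append)
    let ?S = "birkhoff \<phi> (length w)"
    have "ereal \<bar>?S y - ?S z\<bar> \<le> V_u X \<phi> x w"
      unfolding V_u_def using y zD by (intro SUP_upper2[where i = "(y, z)"]) auto
    then have "exp_ereal (ereal (?S y - ?S z)) \<le> exp_ereal (V_u X \<phi> x w)"
      by (intro exp_ereal_mono) (meson abs_ge_self ereal_less_eq(3) order_trans)
    then have V: "ennreal (exp (?S y - ?S z)) \<le> exp_ereal (V_u X \<phi> x w)" by simp
    have "ennreal (exp (?S y)) * ennreal (exp (birkhoff \<phi> (length v) z')) =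
        ennreal (exp (?S y - ?S z)) * ennreal (exp (birkhoff \<phi> (length (w @ v)) z))"
      by (simp add: z birkhoff_add flip: exp_add ennreal_mult')
    also have "\<dots> \<le> exp_ereal (V_u X \<phi> x w) * leaf_weight x (w @ v)"
      using V zD zD' by (intro mult_mono leaf_weight_upper) auto
    finally show ?thesis .
  qed
  then show ?thesis
    unfolding leaf_weight_eq[of x w] leaf_weight_eq[of _ v]
    by (auto simp: SUP_mult_left_ennreal SUP_mult_right_ennreal intro!: SUP_least)
qed

section \<open>Normalised weights and finite covers of a leaf\<close>

abbreviation (input) "P \<equiv> pressure X \<phi>"

text \<open>The summand in the covering sums of the leaf measure. Its normalising factor is
  multiplicative under concatenation, so the inequalities for weights pass to costs.\<close>

definition cost :: "(int \<Rightarrow> 'a) \<Rightarrow> 'a list \<Rightarrow> ennreal" where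
  "cost x u = leaf_weight x u * ennreal (exp (- (real (length u) * P)))"

lemma exp_ereal_Phi_u: "exp_ereal (Phi_u X \<phi> x u - ereal (real (length u) * P)) = cost x u"
  by (simp add: exp_ereal_diff cost_def leaf_weight_def)

lemma leaf_sum_eq: "leaf_sum_u X \<phi> x n * ennreal (exp (- (real n * P))) = (\<Sum>u\<in>lang X n. cost x u)"
  unfolding leaf_sum_u_def sum_distrib_right cost_def leaf_weight_def
  by (rule sum.cong) (auto simp: lang_def)

lemma cost_less_top: "cost x u < top"
  unfolding cost_def using leaf_weight_less_top by (simp add: ennreal_mult_less_top)

lemma ennreal_partition_sum:
  "ennreal (partition_sum X \<phi> n) = (\<Sum>u\<in>lang X n. ennreal (exp (word_sup X \<phi> u)))"
  unfolding partition_sum_def by (rule sum_ennreal[symmetric]) simp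

text \<open>If a word of length k occurs in the leaf, a point carrying it is covered by some v in F,
  and v is then a prefix of the word. Grouping by prefixes leaves remainders of length k - |v|,
  which the global partition sum bounds.\<close>

lemma leaf_sum_le_cover:
  assumes F: "finite F" "Wu X z \<subseteq> (\<Union>v\<in>F. cyl_fwd X v)" and k: "\<forall>v\<in>F. length v \<le> k"
  shows "leaf_sum_u X \<phi> z k \<le>
    (\<Sum>v\<in>F. leaf_weight z v * ennreal (partition_sum X \<phi> (k - length v)))"
proof -
  let ?L = "\<lambda>v. {u \<in> lang X k. take (length v) u = v}"
  \<comment> \<open>Words missing the leaf weigh 0. A word with several prefixes in F is counted
    several times, which only enlarges the bound.\<close>
  have "leaf_weight z u \<le> (\<Sum>v\<in>F. if take (length v) u = v then leaf_weight z u else 0)"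
    if u: "u \<in> lang X k" for u
  proof (cases "Wu X z \<inter> cyl_fwd X u = {}")
    case True
    then show ?thesis by (simp add: leaf_weight_empty)
  next
    case False
    then obtain y where y: "y \<in> Wu X z" "y \<in> cyl_fwd X u" by blast
    then obtain v where v: "v \<in> F" "y \<in> cyl_fwd X v" using F(2) by blast
    have "length u = k" using u by (simp add: lang_def)
    then have "take (length v) u = v"
      using v y k by (auto simp: cyl_fwd_def intro!: nth_equalityI)
    then show ?thesis
      using v(1) F(1) sum_nonneg_leq_bound[OF F(1) _ refl v(1),
          of "\<lambda>v. if take (length v) u = v then leaf_weight z u else 0"]
      by simp
  qed
  then have "leaf_sum_u X \<phi> z k \<le>
      (\<Sum>u\<in>lang X k. \<Sum>v\<in>F. if take (length v) u = v then leaf_weight z u else 0)"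
    unfolding leaf_sum_u_def leaf_weight_def[symmetric] by (rule sum_mono)
  also have "\<dots> = (\<Sum>v\<in>F. \<Sum>u\<in>?L v. leaf_weight z u)"
    by (subst sum.swap, rule sum.cong, simp, subst sum.inter_filter, simp_all add: finite_lang)
  also have "\<dots> \<le> (\<Sum>v\<in>F. leaf_weight z v * ennreal (partition_sum X \<phi> (k - length v)))"
  proof (rule sum_mono)
    fix v assume "v \<in> F"
    have split: "v @ drop (length v) u = u" if "u \<in> ?L v" for u
      using that by (metis (mono_tags, lifting) append_take_drop_id mem_Collect_eq)
    \<comment> \<open>With the prefix v fixed, a word is recovered from its remainder.\<close>
    have inj: "inj_on (drop (length v)) (?L v)"
      by (rule inj_onI) (metis split)
    have "(\<Sum>u\<in>?L v. leaf_weight z u) \<le>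
        (\<Sum>u\<in>?L v. leaf_weight z v * ennreal (exp (word_sup X \<phi> (drop (length v) u))))"
      using leaf_weight_append_le_word_sup[of z v] split by (intro sum_mono) metis
    also have "\<dots> = leaf_weight z v *
        (\<Sum>u\<in>drop (length v) ` ?L v. ennreal (exp (word_sup X \<phi> u)))"
      unfolding sum.reindex[OF inj] by (simp only: o_def sum_distrib_left)
    also have "drop (length v) ` ?L v \<subseteq> lang X (k - length v)"
    proof clarify
      fix u assume "u \<in> lang X k" "take (length v) u = v"
      then show "drop (length v) u \<in> lang X (k - length v)"
        using lang_append_right[of v "drop (length v) u" k] split[of u] by simp
    qed
    then have "leaf_weight z v * (\<Sum>u\<in>drop (length v) ` ?L v. ennreal (exp (word_sup X \<phi> u))) \<le>
        leaf_weight z v * ennreal (partition_sum X \<phi> (k - length v))"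
      unfolding ennreal_partition_sum
      by (intro mult_left_mono sum_mono2 finite_lang) auto
    finally show "(\<Sum>u\<in>?L v. leaf_weight z u) \<le>
        leaf_weight z v * ennreal (partition_sum X \<phi> (k - length v))" .
  qed
  finally show ?thesis .
qed

text \<open>After normalisation the prefix sum bound becomes a combination of shifted global terms.
  Finiteness of F bounds the shifts and makes the total cost finite, so the limit superior may be
  taken.\<close>

lemma Q_upper_u_le_cover:
  assumes F: "finite F" "Wu X z \<subseteq> (\<Union>v\<in>F. cyl_fwd X v)"
  shows "Q_upper_u X \<phi> z \<le> (\<Sum>v\<in>F. cost z v) * Q_upper X \<phi>"
  unfolding Q_upper_u_def Q_upper_def
proof (rule limsup_le_mult_limsup)
  let ?a = "\<lambda>n. ennreal (partition_sum X \<phi> n * exp (- (real n * P)))"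
  show "(\<Sum>v\<in>F. cost z v) < top" using F(1) cost_less_top by simp
  fix K
  obtain m where m: "\<forall>v\<in>F. length v \<le> m"
    using F(1) by (metis finite_imageI finite_nat_set_iff_bounded_le imageI)
  show "\<forall>\<^sub>F k in sequentially. leaf_sum_u X \<phi> z k * ennreal (exp (- (real k * P))) \<le>
      (\<Sum>v\<in>F. cost z v) * (SUP i\<in>{K..}. ?a i)"
  proof (rule eventually_sequentiallyI)
    \<comment> \<open>Since m bounds the lengths in F, every remainder length k - |v| is at least
      K.\<close>
    fix k assume k: "k \<ge> m + K"
    have "leaf_sum_u X \<phi> z k * ennreal (exp (- (real k * P))) \<le>
      (\<Sum>v\<in>F. leaf_weight z v * ennreal (partition_sum X \<phi> (k - length v))) *
        ennreal (exp (- (real k * P)))"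
      using m k by (intro mult_right_mono leaf_sum_le_cover F) force+
    also have "\<dots> = (\<Sum>v\<in>F. cost z v * ?a (k - length v))"
      unfolding sum_distrib_right
    proof (rule sum.cong[OF refl])
      fix v assume "v \<in> F"
      then have v: "length v \<le> k" using m k by force
      then have "exp (- (real k * P)) =
          exp (- (real (length v) * P)) * exp (- (real (k - length v) * P))"
        by (simp add: of_nat_diff algebra_simps flip: exp_add)
      then show "leaf_weight z v * ennreal (partition_sum X \<phi> (k - length v)) *
          ennreal (exp (- (real k * P))) = cost z v * ?a (k - length v)"
        by (simp add: cost_def ennreal_mult' ennreal_mult'' mult_ac)
    qed
    also have "\<dots> \<le> (\<Sum>v\<in>F. cost z v * (SUP i\<in>{K..}. ?a i))"
    proof (intro sum_mono mult_left_mono)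
      fix v assume "v \<in> F"
      then have "k - length v \<in> {K..}" using m k by force
      then show "?a (k - length v) \<le> (SUP i\<in>{K..}. ?a i)" by (rule SUP_upper)
    qed simp
    finally show "leaf_sum_u X \<phi> z k * ennreal (exp (- (real k * P))) \<le>
      (\<Sum>v\<in>F. cost z v) * (SUP i\<in>{K..}. ?a i)" by (simp add: sum_distrib_right)
  qed
qed

text \<open>Coordinate conditions make the leaf cylinder a closed part of the compact X, while each
  covering cylinder is the trace on X of an open set.\<close>

lemma finite_subcover_leaf_cyl:
  assumes "Wu X x \<inter> cyl_fwd X w \<subseteq> (\<Union>u\<in>E. cyl_fwd X u)"
  obtains F where "finite F" "F \<subseteq> E" "Wu X x \<inter> cyl_fwd X w \<subseteq> (\<Union>u\<in>F. cyl_fwd X u)"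
proof -
  let ?T = "product_topology (\<lambda>_. discrete_topology A) (UNIV :: int set)"
  let ?S = "{y. \<forall>i. y i \<in> A}"
  have top: "topspace ?T = ?S" by (auto simp: PiE_iff extensional_def)
  have closed_coordinate: "closedin ?T {y. (\<forall>i. y i \<in> A) \<and> y k \<in> U}" for k U
  proof -
    have "?S - {y. (\<forall>i. y i \<in> A) \<and> y k \<in> U} = {y. (\<forall>i. y i \<in> A) \<and> y k \<in> - U}" by auto
    then show ?thesis
      using openin_coordinate[of A k "- U"] unfolding closedin_def top by auto
  qed
  \<comment> \<open>The index i runs up to \<open>length w\<close> inclusive, with a guard that is
    vacuous at the end, so that the intersection has a nonempty index set even for the empty word.
    The open sets \<open>C u\<close> below use the same device.\<close>
  let ?C = "(\<Inter>k\<in>{..0}. {y. (\<forall>i. y i \<in> A) \<and> y k \<in> {x k}}) \<inter>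
      (\<Inter>i\<in>{..length w}. {y. (\<forall>i. y i \<in> A) \<and> y (int i) \<in> {c. i < length w \<longrightarrow> c = w ! i}})"
  have "closedin ?T ?C"
    by (intro closedin_Int closedin_INT closed_coordinate) auto
  then have "compactin ?T (?C \<inter> X)" using compact by (rule closed_Int_compactin)
  moreover have "?C \<inter> X = Wu X x \<inter> cyl_fwd X w"
    by (auto simp: Wu_def cyl_fwd_def letter_in)
  ultimately have comp: "compactin ?T (Wu X x \<inter> cyl_fwd X w)" by simp
  define C where "C u = (\<Inter>i\<in>{..length u}.
      {y. (\<forall>i. y i \<in> A) \<and> y (int i) \<in> {c. i < length u \<longrightarrow> c = u ! i}})" for u
  have "openin ?T (C u)" for u
    unfolding C_def by (intro openin_INT2 openin_coordinate) auto
  moreover have C: "C u \<inter> X = cyl_fwd X u" for u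
    by (auto simp: C_def cyl_fwd_def letter_in)
  then have "Wu X x \<inter> cyl_fwd X w \<subseteq> \<Union>(C ` E)" using assms by blast
  ultimately obtain \<F> where "finite \<F>" "\<F> \<subseteq> C ` E" "Wu X x \<inter> cyl_fwd X w \<subseteq> \<Union>\<F>"
    using compactinD[OF comp, of "C ` E"] by blast
  then obtain F where F: "finite F" "F \<subseteq> E" "Wu X x \<inter> cyl_fwd X w \<subseteq> \<Union>(C ` F)"
    by (metis finite_subset_image)
  moreover have "Wu X x \<inter> cyl_fwd X w \<subseteq> X" by (auto simp: Wu_def)
  ultimately have "Wu X x \<inter> cyl_fwd X w \<subseteq> (\<Union>u\<in>F. cyl_fwd X u)"
    unfolding C[symmetric] by blast
  with F that show thesis by blast
qed

section \<open>Costs of concatenations and the two bounds for the leaf measure\<close>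

lemma exp_length_append:
  "ennreal (exp (- (real (length (w @ v)) * P))) =
    ennreal (exp (- (real (length w) * P))) * ennreal (exp (- (real (length v) * P)))"
  by (simp add: distrib_right exp_add algebra_simps flip: ennreal_mult' exp_add)

lemma cost_append_le:
  assumes "w \<noteq> []" "w ! 0 = x 0" "v \<noteq> []"
  shows "cost x (w @ v) \<le> cost x w * cost (concat_u x w (hd v)) v"
  using mult_right_mono[OF leaf_weight_append_le[where x = x, OF assms] zero_le,
      where c = "ennreal (exp (- (real (length (w @ v)) * P)))"]
  unfolding cost_def exp_length_append by (simp only: mult_ac)

lemma cost_mult_le:
  assumes "w \<noteq> []" "w ! 0 = x 0"
  shows "cost x w * cost (concat_u x w a) v \<le> exp_ereal (V_u X \<phi> x w) * cost x (w @ v)"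
  using mult_right_mono[OF leaf_weight_mult_le[where x = x, OF assms] zero_le,
      where c = "ennreal (exp (- (real (length (w @ v)) * P)))"]
  unfolding cost_def exp_length_append by (simp only: mult_ac)

text \<open>Raising N leaves fewer covers, so the infima increase; the limit exists and is their
  supremum.\<close>

lemma m_u_eq_SUP:
  "m_u X \<phi> x Z = (SUP N. INF E\<in>covers_u X Z N. \<Sum>\<^sub>\<infinity>u\<in>E. cost x u)"
  unfolding m_u_def exp_ereal_Phi_u
proof (rule limI, rule LIMSEQ_SUP, rule monoI)
  fix M N :: nat assume "M \<le> N"
  then have "covers_u X Z N \<subseteq> covers_u X Z M"
    by (auto simp: covers_u_def lang_ge_def subset_iff) (meson atLeast_iff order_trans)
  then show "(INF E\<in>covers_u X Z M. \<Sum>\<^sub>\<infinity>u\<in>E. cost x u) \<le> (INF E\<in>covers_u X Z N. \<Sum>\<^sub>\<infinity>u\<in>E. cost x u)"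
    by (intro INF_superset_mono) auto
qed

text \<open>Covering words are strictly longer than w, so each one that meets the leaf cylinder is
  wv with v nonempty, and the first letter of v assigns it to one leaf x.wa. The covering bounds for
  these leaves are then added over a.\<close>

lemma sum_Q_upper_le_cover:
  assumes w: "w \<noteq> []" "w ! 0 = x 0"
    and E: "E \<in> covers_u X (Wu X x \<inter> cyl_fwd X w) (Suc (length w))"
  shows "(\<Sum>a\<in>A. Q_upper_u X \<phi> (concat_u x w a)) * cost x w \<le>
    exp_ereal (V_u X \<phi> x w) * Q_upper X \<phi> * (\<Sum>\<^sub>\<infinity>u\<in>E. cost x u)"
proof -
  let ?Z = "Wu X x \<inter> cyl_fwd X w"
  have E_lang: "E \<subseteq> lang_ge X (Suc (length w))" and "?Z \<subseteq> (\<Union>u\<in>E. cyl_fwd X u)"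
    using E by (auto simp: covers_u_def)
  then obtain F where F: "finite F" "F \<subseteq> E" "?Z \<subseteq> (\<Union>u\<in>F. cyl_fwd X u)"
    using finite_subcover_leaf_cyl by metis
  define G where "G = {v. v \<noteq> [] \<and> w @ v \<in> F}"
  have "finite ((\<lambda>v. w @ v) -` F)" using F(1) by (rule finite_vimageI) (simp add: inj_on_def)
  then have finG: "finite G" by (rule rev_finite_subset) (auto simp: G_def)
  have hdG: "hd ` G \<subseteq> A"
  proof clarify
    fix v assume v: "v \<in> G"
    then have "w @ v \<in> lang_ge X (Suc (length w))" using F(2) E_lang by (auto simp: G_def)
    then obtain m where "w @ v \<in> lang X m" by (auto simp: lang_ge_def)
    then have "set (w @ v) \<subseteq> A" by (rule lang_letters)
    then show "hd v \<in> A" using v by (auto simp: G_def)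
  qed
  have cover: "Wu X (concat_u x w a) \<subseteq> (\<Union>v\<in>{v \<in> G. hd v = a}. cyl_fwd X v)" for a
  proof
    fix z' assume z': "z' \<in> Wu X (concat_u x w a)"
    then have "z' \<in> (shift ^^ length w) ` X" using funpow_shift_image by (simp add: Wu_def)
    then obtain z where z: "z \<in> X" "z' = (shift ^^ length w) z" by blast
    then have zD: "z \<in> Wu X x" "z \<in> cyl_fwd X w" "z (int (length w)) = a"
      using z' Wu_concat_iff w by blast+
    then obtain u where u: "u \<in> F" "z \<in> cyl_fwd X u" using F(3) by blast
    then have "u \<in> lang_ge X (Suc (length w))" using F(2) E_lang by blast
    then have len: "length w < length u" by (auto simp: lang_ge_def lang_def)
    define v where "v = drop (length w) u"
    have "take (length w) u = w"
      using zD u len by (intro nth_equalityI) (auto simp: cyl_fwd_def)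
    then have uv: "u = w @ v" by (metis append_take_drop_id v_def)
    have "v \<noteq> []" using len by (simp add: v_def)
    moreover have "z' \<in> cyl_fwd X v" using u z by (simp add: uv mem_cyl_append)
    moreover have "hd v = a"
      using \<open>z' \<in> cyl_fwd X v\<close> \<open>v \<noteq> []\<close> zD z by (auto simp: cyl_fwd_def funpow_shift hd_conv_nth)
    ultimately show "z' \<in> (\<Union>v\<in>{v \<in> G. hd v = a}. cyl_fwd X v)"
      using u by (auto simp: G_def uv)
  qed
  have "(\<Sum>a\<in>A. Q_upper_u X \<phi> (concat_u x w a)) * cost x w \<le>
      (\<Sum>a\<in>A. (\<Sum>v\<in>{v \<in> G. hd v = a}. cost (concat_u x w a) v) * Q_upper X \<phi>) * cost x w"
    using finG by (intro mult_right_mono sum_mono Q_upper_u_le_cover cover) auto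
  also have "\<dots> = (\<Sum>a\<in>A. \<Sum>v\<in>{v \<in> G. hd v = a}. cost x w * cost (concat_u x w a) v) * Q_upper X \<phi>"
    by (simp add: sum_distrib_left sum_distrib_right mult_ac)
  also have "\<dots> \<le> (\<Sum>a\<in>A. \<Sum>v\<in>{v \<in> G. hd v = a}. exp_ereal (V_u X \<phi> x w) * cost x (w @ v)) *
      Q_upper X \<phi>"
    by (intro mult_right_mono sum_mono cost_mult_le w) auto
  \<comment> \<open>The first letters of G lie in A, so the groups with fixed first letter partition
    G.\<close>
  also have "\<dots> = exp_ereal (V_u X \<phi> x w) * Q_upper X \<phi> * (\<Sum>v\<in>G. cost x (w @ v))"
    by (subst sum.group[OF finG finite_alphabet hdG]) (simp add: sum_distrib_left[symmetric] mult_ac)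
  also have "(\<Sum>v\<in>G. cost x (w @ v)) = (\<Sum>u\<in>(\<lambda>v. w @ v) ` G. cost x u)"
    by (simp add: sum.reindex inj_on_def)
  also have "\<dots> \<le> (\<Sum>u\<in>F. cost x u)"
    using F(1) by (intro sum_mono2) (auto simp: G_def)
  also have "\<dots> \<le> (\<Sum>\<^sub>\<infinity>u\<in>E. cost x u)"
    using F by (subst nonneg_infsum_complete) (auto intro: SUP_upper)
  finally show ?thesis by (simp add: mult_left_mono)
qed

text \<open>The measure is a supremum over N, so it dominates the infimum at N = |w| + 1, where
  every covering word is longer than w. A nonempty leaf cylinder makes the cost of w positive and
  finite, which permits division.\<close>

lemma m_u_lower_bound:
  assumes ne: "Wu X x \<inter> cyl_fwd X w \<noteq> {}" and w: "w \<noteq> []"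
  shows "(\<Sum>a\<in>A. Q_upper_u X \<phi> (concat_u x w a)) / (exp_ereal (V_u X \<phi> x w) * Q_upper X \<phi>) \<le>
    m_u X \<phi> x (Wu X x \<inter> cyl_fwd X w) / cost x w"
    (is "?T / ?D \<le> m_u X \<phi> x ?Z / _")
proof -
  have c: "cost x w \<noteq> 0" "cost x w \<noteq> top"
    using leaf_weight_pos[OF ne] cost_less_top[of x w] by (auto simp: cost_def)
  have w0: "w ! 0 = x 0" using ne w by (force simp: Wu_def cyl_fwd_def)
  have "?T / ?D * cost x w \<le> (\<Sum>\<^sub>\<infinity>u\<in>E. cost x u)"
    if "E \<in> covers_u X ?Z (Suc (length w))" for E
  proof -
    have "?T / ?D * cost x w \<le> (\<Sum>\<^sub>\<infinity>u\<in>E. cost x u) / cost x w * cost x w"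
      using sum_Q_upper_le_cover[OF w w0 that] c
      by (intro mult_right_mono ennreal_divide_le_divide) auto
    also have "\<dots> = (\<Sum>\<^sub>\<infinity>u\<in>E. cost x u)"
      using c by (metis ennreal_times_divide ennreal_mult_divide_eq mult.commute)
    finally show ?thesis .
  qed
  then have "?T / ?D * cost x w \<le> (INF E\<in>covers_u X ?Z (Suc (length w)). \<Sum>\<^sub>\<infinity>u\<in>E. cost x u)"
    by (rule INF_greatest)
  also have "\<dots> \<le> m_u X \<phi> x ?Z" unfolding m_u_eq_SUP by (rule SUP_upper) simp
  finally have "?T / ?D * cost x w / cost x w \<le> m_u X \<phi> x ?Z / cost x w"
    by (rule divide_right_mono_ennreal)
  then show ?thesis using c by (simp add: ennreal_mult_divide_eq)
qed

text \<open>Letting the word length depend on the letter after w produces the sum of the lower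
  limits. One common length would only give the lower limit of the sum, which may be larger.\<close>

lemma m_u_upper_bound:
  assumes ne: "Wu X x \<inter> cyl_fwd X w \<noteq> {}" and w: "w \<noteq> []"
  shows "m_u X \<phi> x (Wu X x \<inter> cyl_fwd X w) / cost x w \<le> (\<Sum>a\<in>A. Q_lower_u X \<phi> (concat_u x w a))"
    (is "m_u X \<phi> x ?Z / _ \<le> ?Q")
proof -
  have c: "cost x w \<noteq> 0" "cost x w < top"
    using leaf_weight_pos[OF ne] cost_less_top[of x w] by (auto simp: cost_def)
  have w0: "w ! 0 = x 0" using ne w by (force simp: Wu_def cyl_fwd_def)
  define b where "b a m = (\<Sum>v\<in>lang X m. cost (concat_u x w a) v)" for a m
  have "\<exists>r. strict_mono r \<and> (b a \<circ> r) \<longlonglongrightarrow> liminf (b a)" for a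
    by (rule liminf_subseq_lim)
  then obtain r where r: "\<And>a. strict_mono (r a)" "\<And>a. (b a \<circ> r a) \<longlonglongrightarrow> liminf (b a)"
    by metis
  have liminf_b: "liminf (b a) = Q_lower_u X \<phi> (concat_u x w a)" for a
    unfolding Q_lower_u_def leaf_sum_eq b_def ..
  have "(INF E\<in>covers_u X ?Z N. \<Sum>\<^sub>\<infinity>u\<in>E. cost x u) \<le> cost x w * ?Q" for N
  proof (rule LIMSEQ_le_const)
    show "(\<lambda>k. cost x w * (\<Sum>a\<in>A. b a (r a k))) \<longlonglongrightarrow> cost x w * ?Q"
      using r(2) liminf_b c by (intro ennreal_tendsto_cmult tendsto_sum) (simp_all add: o_def)
    have "(INF E\<in>covers_u X ?Z N. \<Sum>\<^sub>\<infinity>u\<in>E. cost x u) \<le> cost x w * (\<Sum>a\<in>A. b a (r a k))"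
      if k: "k \<ge> Suc N" for k
    proof -
      \<comment> \<open>A strictly increasing sequence of naturals dominates its index; hence the
        words v are nonempty and wv has length at least N.\<close>
      have rk: "Suc N \<le> r a k" for a using seq_suble[OF r(1)] k order_trans by blast
      \<comment> \<open>Requiring wv to be in the language makes these words admissible in a cover;
        fixing the first letter makes the sets for different a disjoint.\<close>
      define G where "G a = {v \<in> lang X (r a k). hd v = a \<and> w @ v \<in> lang X (length w + r a k)}" for a
      define E where "E = (\<lambda>v. w @ v) ` (\<Union>a\<in>A. G a)"
      have G: "finite (G a)" "G a \<subseteq> lang X (r a k)" for a
        using finite_lang by (auto simp: G_def)
      have "?Z \<subseteq> (\<Union>u\<in>E. cyl_fwd X u)"
      proof
        fix y assume y: "y \<in> ?Z"
        define a where "a = y (int (length w))"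
        \<comment> \<open>The letters of y behind w, read for the length attached to the first of
          them.\<close>
        define v where "v = map (\<lambda>i. y (int i + int (length w))) [0..<r a k]"
        have yX: "y \<in> X" using y by (simp add: Wu_def)
        then have "(shift ^^ length w) y \<in> cyl_fwd X v"
          using funpow_shift_in by (auto simp: cyl_fwd_def v_def funpow_shift)
        then have cyl: "y \<in> cyl_fwd X (w @ v)" using y by (simp add: mem_cyl_append)
        then have "w @ v \<in> lang X (length w + r a k)" by (auto simp: lang_def v_def)
        moreover from this have "v \<in> lang X (r a k)" using lang_append_right by fastforce
        moreover have "hd v = a" using rk[of a] by (simp add: v_def a_def hd_map hd_conv_nth)
        ultimately have "v \<in> G a" by (simp add: G_def)
        moreover have "a \<in> A" using letter_in yX by (simp add: a_def)
        ultimately show "y \<in> (\<Union>u\<in>E. cyl_fwd X u)" using cyl by (auto simp: E_def)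
      qed
      moreover have "E \<subseteq> lang_ge X N"
      proof clarify
        fix u assume "u \<in> E"
        then obtain a where "u \<in> lang X (length w + r a k)" by (auto simp: E_def G_def)
        moreover have "N \<le> length w + r a k" using rk[of a] by simp
        ultimately show "u \<in> lang_ge X N" by (auto simp: lang_ge_def)
      qed
      ultimately have "E \<in> covers_u X ?Z N" by (simp add: covers_u_def)
      then have "(INF E\<in>covers_u X ?Z N. \<Sum>\<^sub>\<infinity>u\<in>E. cost x u) \<le> (\<Sum>\<^sub>\<infinity>u\<in>E. cost x u)"
        by (rule INF_lower)
      also have "\<dots> = (\<Sum>u\<in>E. cost x u)"
        using G finite_alphabet by (simp add: E_def)
      also have "\<dots> = (\<Sum>v\<in>(\<Union>a\<in>A. G a). cost x (w @ v))"
        by (simp add: E_def sum.reindex inj_on_def)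
      also have "\<dots> = (\<Sum>a\<in>A. \<Sum>v\<in>G a. cost x (w @ v))"
        using G finite_alphabet by (intro sum.UNION_disjoint) (auto simp: G_def)
      also have "\<dots> \<le> (\<Sum>a\<in>A. \<Sum>v\<in>G a. cost x w * cost (concat_u x w a) v)"
      proof (intro sum_mono)
        fix a v assume v: "v \<in> G a"
        then have "v \<noteq> []" using rk[of a] by (auto simp: G_def lang_def)
        then show "cost x (w @ v) \<le> cost x w * cost (concat_u x w a) v"
          using cost_append_le[of w x v] w w0 v by (simp add: G_def)
      qed
      also have "\<dots> \<le> (\<Sum>a\<in>A. \<Sum>v\<in>lang X (r a k). cost x w * cost (concat_u x w a) v)"
        using G finite_lang by (intro sum_mono sum_mono2) auto
      also have "\<dots> = cost x w * (\<Sum>a\<in>A. b a (r a k))"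
        by (simp add: b_def sum_distrib_left)
      finally show ?thesis .
    qed
    then show "\<exists>M. \<forall>k\<ge>M. (INF E\<in>covers_u X ?Z N. \<Sum>\<^sub>\<infinity>u\<in>E. cost x u) \<le>
        cost x w * (\<Sum>a\<in>A. b a (r a k))" by blast
  qed
  then have "m_u X \<phi> x ?Z \<le> cost x w * ?Q"
    unfolding m_u_eq_SUP by (intro SUP_least) 
  then have "m_u X \<phi> x ?Z / cost x w \<le> cost x w * ?Q / cost x w"
    by (rule divide_right_mono_ennreal)
  also have "\<dots> = ?Q" using c by (metis ennreal_mult_divide_eq less_irrefl mult.commute)
  finally show ?thesis .
qed

end

section \<open>Compactness of shift spaces\<close>

text \<open>Sequences agreeing at all positions of absolute value at most m are within 2^(-m) of
  each other, so every metric ball contains a neighbourhood given by finitely many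
  coordinates.\<close>

lemma continuous_map_id_shift_metric:
  assumes "\<And>y i. y \<in> M \<Longrightarrow> y i \<in> A"
  shows "continuous_map (subtopology (product_topology (\<lambda>_. discrete_topology A) UNIV) M)
    (Metric_space.mtopology M shift_dist) id"
  unfolding Metric_space.continuous_map_to_metric[OF Metric_space_shift_dist]
proof (intro ballI allI impI)
  let ?T = "product_topology (\<lambda>_. discrete_topology A) (UNIV :: int set)"
  fix x :: "int \<Rightarrow> 'a" and e :: real
  assume "x \<in> topspace (subtopology ?T M)" and e: "e > 0"
  then have x: "x \<in> M" by simp
  obtain m :: nat where m: "inverse (2 ^ m) < e"
    using real_arch_pow_inv[of e "1/2"] e by (auto simp: power_one_over inverse_eq_divide)
  let ?U = "(\<Inter>k\<in>{- int m..int m}. {y. (\<forall>i. y i \<in> A) \<and> y k \<in> {x k}})"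
  have "openin ?T ?U" by (intro openin_INT2 openin_coordinate) auto
  then have "openin (subtopology ?T M) (M \<inter> ?U)" by (rule openin_subtopology_Int2)
  moreover have "x \<in> M \<inter> ?U" using x assms by auto
  moreover have "shift_dist x y < e" if y: "y \<in> ?U" for y
  proof (cases "x = y")
    case True
    then show ?thesis using e by (simp add: shift_dist_def)
  next
    case False
    then obtain n where n: "x n \<noteq> y n" "shift_dist x y = 2 powr - real (nat \<bar>n\<bar>)"
      by (rule shift_dist_attained)
    have "n \<notin> {- int m..int m}" using y n(1) by force
    then have "m \<le> nat \<bar>n\<bar>" by auto
    then have "shift_dist x y \<le> 2 powr - real m" unfolding n(2) by simp
    also have "\<dots> = inverse (2 ^ m)" by (simp add: powr_minus powr_realpow)
    finally show ?thesis using m by simp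
  qed
  ultimately show "\<exists>U. openin (subtopology ?T M) U \<and> x \<in> U \<and>
      (\<forall>y\<in>U. id y \<in> Metric_space.mball M shift_dist (id x) e)"
    using x by (intro exI[of _ "M \<inter> ?U"])
      (auto simp: Metric_space.in_mball[OF Metric_space_shift_dist])
qed

text \<open>Continuity of the identity pulls closedness of X and continuity of the potential back to
  the product topology. There the full shift is compact, so X is compact and the potential is
  bounded on it.\<close>

lemma bounded_subshift_exists:
  assumes A: "finite A" and X: "two_sided_shift_space A X" and \<phi>: "continuous_potential X \<phi>"
  obtains B where "bounded_subshift A X \<phi> B"
proof -
  let ?T = "product_topology (\<lambda>_. discrete_topology A) (UNIV :: int set)"
  have closed: "closedin (Metric_space.mtopology (UNIV \<rightarrow> A) shift_dist) X" and "shift ` X = X"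
    using X by (auto simp: two_sided_shift_space_def)
  then have letters: "X \<subseteq> (UNIV \<rightarrow> A)"
    using closedin_subset Metric_space.topspace_mtopology[OF Metric_space_shift_dist] by metis
  have top: "topspace ?T = (UNIV \<rightarrow> A)" by (auto simp: PiE_iff extensional_def)
  have "continuous_map (subtopology ?T (UNIV \<rightarrow> A)) (Metric_space.mtopology (UNIV \<rightarrow> A) shift_dist) id"
    by (rule continuous_map_id_shift_metric) auto
  moreover have "subtopology ?T (UNIV \<rightarrow> A) = ?T" using top by (metis subtopology_topspace)
  ultimately have "continuous_map ?T (Metric_space.mtopology (UNIV \<rightarrow> A) shift_dist) id"
    by simp
  then have "closedin ?T {y \<in> topspace ?T. id y \<in> X}"
    using closed by (rule closedin_continuous_map_preimage)
  moreover have "{y \<in> topspace ?T. id y \<in> X} = X" using letters top by auto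
  ultimately have "closedin ?T X" by simp
  moreover have "compact_space ?T"
    using A by (simp add: compact_space_product_topology compact_space_discrete_topology)
  ultimately have compact: "compactin ?T X" by (rule closedin_compact_space[rotated])
  have "continuous_map (subtopology ?T X) euclideanreal (\<phi> \<circ> id)"
    using \<phi> letters unfolding continuous_potential_def
    by (intro continuous_map_compose[OF continuous_map_id_shift_metric]) auto
  moreover have "compactin (subtopology ?T X) X" using compact by (simp add: compactin_subtopology)
  ultimately have "compactin euclideanreal ((\<phi> \<circ> id) ` X)" by (rule image_compactin[rotated])
  then have "bounded (\<phi> ` X)" by (simp add: compact_imp_bounded)
  then obtain B where "\<forall>y\<in>X. \<bar>\<phi> y\<bar> \<le> B" by (auto simp: bounded_iff)
  then have "bounded_subshift A X \<phi> B"
    using A letters compact \<open>shift ` X = X\<close> by unfold_locales auto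
  then show thesis by (rule that)
qed

section \<open>Time reversal\<close>

text \<open>Reversal fixes position 0. It therefore exchanges the two kinds of leaves, and turns
  words ending at 0 into reversed words starting at 0.\<close>

definition reflect :: "(int \<Rightarrow> 'a) \<Rightarrow> int \<Rightarrow> 'a" where
  "reflect y = (\<lambda>k. y (- k))"

lemma reflect_reflect [simp]: "reflect (reflect y) = y"
  by (simp add: reflect_def)

lemma mem_reflect_image: "y \<in> reflect ` Z \<longleftrightarrow> reflect y \<in> Z"
  by (metis image_iff reflect_reflect)

lemma shift_reflect: "shift (reflect y) = reflect (inv shift y)"
  by (simp add: reflect_def shift_def inv_shift fun_eq_iff)

lemma birkhoff_reflect: "birkhoff (\<phi> \<circ> reflect) n (reflect y) = birkhoff_bwd \<phi> n y"
  by (simp add: birkhoff_def birkhoff_bwd_def funpow_shift funpow_inv_shift reflect_def)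

lemma Wu_reflect: "Wu (reflect ` X) (reflect x) = reflect ` Ws X x"
proof -
  have "(\<forall>k\<le>0. y k = x (- k)) \<longleftrightarrow> (\<forall>k\<ge>0. y (- k) = x k)" for y :: "int \<Rightarrow> 'a"
    by (metis minus_minus neg_0_le_iff_le neg_le_0_iff_le)
  then show ?thesis
    by (auto simp: Wu_def Ws_def mem_reflect_image) (auto simp: reflect_def)
qed

lemma all_less_rev: "(\<forall>i<n. Q i) \<longleftrightarrow> (\<forall>i<n. Q (n - Suc i))" for n :: nat
proof (intro iffI allI impI)
  fix i assume Q: "\<forall>i<n. Q (n - Suc i)" and i: "i < n"
  have "n - Suc i < n" using i by simp
  then have "Q (n - Suc (n - Suc i))" using Q by blast
  moreover have "n - Suc (n - Suc i) = i" using i by simp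
  ultimately show "Q i" by simp
qed auto

lemma cyl_fwd_reflect: "cyl_fwd (reflect ` X) (rev u) = reflect ` cyl_bwd X u"
proof -
  have "(\<forall>i<length u. reflect y (int i) = rev u ! i) \<longleftrightarrow>
      (\<forall>i<length u. y (int i - int (length u) + 1) = u ! i)" for y :: "int \<Rightarrow> 'a"
  proof -
    have "reflect y (int (length u - Suc i)) = y (int i - int (length u) + 1)" if "i < length u" for i
      unfolding reflect_def using that by (intro arg_cong[where f = y]) auto
    then show ?thesis by (subst all_less_rev) (simp add: rev_nth Suc_diff_Suc)
  qed
  from this[of "reflect y" for y] show ?thesis
    by (intro set_eqI) (simp add: mem_reflect_image cyl_fwd_def cyl_bwd_def)
qed

lemma leaf_cyl_reflect:
  "Wu (reflect ` X) (reflect x) \<inter> cyl_fwd (reflect ` X) (rev u) = reflect ` (Ws X x \<inter> cyl_bwd X u)"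
  unfolding Wu_reflect cyl_fwd_reflect
  by (rule image_Int[symmetric]) (metis injI reflect_reflect)

lemma Phi_u_reflect:
  "Phi_u (reflect ` X) (\<phi> \<circ> reflect) (reflect x) (rev u) = Phi_s X \<phi> x u"
  unfolding Phi_u_def Phi_s_def leaf_cyl_reflect by (simp add: image_image birkhoff_reflect)

lemma V_u_reflect: "V_u (reflect ` X) (\<phi> \<circ> reflect) (reflect x) (rev u) = V_s X \<phi> x u"
proof -
  have "(\<lambda>(y, z). ereal \<bar>birkhoff (\<phi> \<circ> reflect) n y - birkhoff (\<phi> \<circ> reflect) n z\<bar>) ` (reflect ` D \<times> reflect ` D) =
      (\<lambda>(y, z). ereal \<bar>birkhoff_bwd \<phi> n y - birkhoff_bwd \<phi> n z\<bar>) ` (D \<times> D)" for n D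
  proof -
    have "reflect ` D \<times> reflect ` D = map_prod reflect reflect ` (D \<times> D)" by auto
    then show ?thesis by (simp add: image_image case_prod_unfold birkhoff_reflect)
  qed
  then show ?thesis unfolding V_u_def V_s_def leaf_cyl_reflect by simp
qed

text \<open>Both padded sequences are \<open>undefined\<close> on the side that the reflection
  exchanges, so they agree as full two-sided functions.\<close>

lemma concat_u_reflect: "concat_u (reflect x) (rev w) a = reflect (concat_s a w x)"
proof
  fix k
  have "rev w ! nat (k + int (length w)) = w ! nat (- k - 1)" if k: "k < 0" "k \<ge> - int (length w)"
  proof -
    have "nat (k + int (length w)) < length w" using k by auto
    moreover have "length w - Suc (nat (k + int (length w))) = nat (- k - 1)" using k by auto
    ultimately show ?thesis by (simp add: rev_nth)
  qed
  then show "concat_u (reflect x) (rev w) a k = reflect (concat_s a w x) k"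
    by (auto simp: concat_u_def concat_s_def reflect_def)
qed

section \<open>The reflected subshift: equal global sums, exchanged leaf quantities\<close>

context bounded_subshift
begin

lemma translate_diff_in: "y \<in> X \<Longrightarrow> (\<lambda>i. y (i - k)) \<in> X"
  using translate_in[of y "- k"] by simp

text \<open>The positions -(n-1), ..., 0 and 0, ..., n-1 differ by a translation by n-1, under which
  X is invariant. Languages and global suprema therefore do not depend on the time
  direction.\<close>

lemma cyl_bwd_eq_translate:
  "cyl_bwd X u = (\<lambda>y i. y (i + (int (length u) - 1))) ` cyl_fwd X u"
proof -
  let ?c = "int (length u) - 1"
  have iff: "y \<in> cyl_bwd X u \<longleftrightarrow> (\<lambda>i. y (i - ?c)) \<in> cyl_fwd X u" for y
  proof -
    have "(\<lambda>i. y (i - ?c)) \<in> X" if "y \<in> X" using that by (rule translate_diff_in)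
    moreover have "y \<in> X" if "(\<lambda>i. y (i - ?c)) \<in> X" using translate_in[OF that, of ?c] by simp
    ultimately show ?thesis by (auto simp: cyl_bwd_def cyl_fwd_def algebra_simps)
  qed
  show ?thesis
  proof (intro equalityI subsetI)
    fix y assume "y \<in> cyl_bwd X u"
    then show "y \<in> (\<lambda>y i. y (i + ?c)) ` cyl_fwd X u"
      unfolding iff by (intro image_eqI[where x = "\<lambda>i. y (i - ?c)"]) simp_all
  next
    fix y assume "y \<in> (\<lambda>y i. y (i + ?c)) ` cyl_fwd X u"
    then show "y \<in> cyl_bwd X u" unfolding iff by auto
  qed
qed

text \<open>Going backwards from time n-1 visits the same orbit points in the opposite
  order.\<close>

lemma birkhoff_bwd_translate: "birkhoff_bwd \<phi> n (\<lambda>i. y (i + (int n - 1))) = birkhoff \<phi> n y"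
proof -
  have "birkhoff_bwd \<phi> n (\<lambda>i. y (i + (int n - 1))) = (\<Sum>k<n. \<phi> (\<lambda>i. y (i + int (n - Suc k))))"
    unfolding birkhoff_bwd_def funpow_inv_shift
    by (intro sum.cong refl arg_cong[where f = \<phi>] ext arg_cong[where f = y]) auto
  also have "\<dots> = birkhoff \<phi> n y"
    unfolding birkhoff_def funpow_shift by (rule sum.nat_diff_reindex)
  finally show ?thesis .
qed

lemma lang_reflect: "lang (reflect ` X) n = rev ` lang X n"
proof -
  have "cyl_fwd (reflect ` X) (rev u) \<noteq> {} \<longleftrightarrow> cyl_fwd X u \<noteq> {}" for u
    by (simp add: cyl_fwd_reflect cyl_bwd_eq_translate)
  then have "rev u \<in> lang (reflect ` X) n \<longleftrightarrow> u \<in> lang X n" for u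
    by (simp add: lang_def)
  then show ?thesis by (metis (no_types, lifting) image_iff rev_rev_ident set_eqI)
qed

lemma word_sup_reflect: "word_sup (reflect ` X) (\<phi> \<circ> reflect) (rev u) = word_sup X \<phi> u"
  by (simp add: word_sup_def cyl_fwd_reflect image_image birkhoff_reflect cyl_bwd_eq_translate
      birkhoff_bwd_translate)

text \<open>Word reversal is a bijection of the languages preserving the suprema, so one pressure
  and one global upper limit serve both kinds of leaves.\<close>

lemma partition_sum_reflect: "partition_sum (reflect ` X) (\<phi> \<circ> reflect) = partition_sum X \<phi>"
  by (simp add: partition_sum_def lang_reflect sum.reindex word_sup_reflect fun_eq_iff)

lemma pressure_reflect: "pressure (reflect ` X) (\<phi> \<circ> reflect) = P"
  by (simp add: pressure_def partition_sum_reflect)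

lemma Q_upper_reflect: "Q_upper (reflect ` X) (\<phi> \<circ> reflect) = Q_upper X \<phi>"
  by (simp add: Q_upper_def partition_sum_reflect pressure_reflect)

lemma leaf_sum_reflect:
  "leaf_sum_u (reflect ` X) (\<phi> \<circ> reflect) (reflect x) = leaf_sum_s X \<phi> x"
  by (simp add: leaf_sum_u_def leaf_sum_s_def lang_reflect sum.reindex Phi_u_reflect fun_eq_iff)

lemma Q_upper_u_reflect: "Q_upper_u (reflect ` X) (\<phi> \<circ> reflect) (reflect x) = Q_upper_s X \<phi> x"
  by (simp add: Q_upper_u_def Q_upper_s_def leaf_sum_reflect pressure_reflect)

lemma Q_lower_u_reflect: "Q_lower_u (reflect ` X) (\<phi> \<circ> reflect) (reflect x) = Q_lower_s X \<phi> x"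
  by (simp add: Q_lower_u_def Q_lower_s_def leaf_sum_reflect pressure_reflect)

text \<open>Reversal preserves word lengths, hence the threshold N, and is its own inverse on
  covers.\<close>

lemma covers_u_reflect:
  "covers_u (reflect ` X) (reflect ` Z) N = image rev ` covers_s X Z N"
proof -
  have "rev ` E \<in> covers_u (reflect ` X) (reflect ` Z) N \<longleftrightarrow> E \<in> covers_s X Z N" for E
  proof -
    have "lang_ge (reflect ` X) N = rev ` lang_ge X N"
      by (simp add: lang_ge_def lang_reflect image_UN)
    moreover have "(\<Union>u\<in>rev ` E. cyl_fwd (reflect ` X) u) = reflect ` (\<Union>u\<in>E. cyl_bwd X u)"
      by (simp add: cyl_fwd_reflect image_UN)
    moreover have "inj (reflect :: (int \<Rightarrow> 'a) \<Rightarrow> _)" by (metis injI reflect_reflect)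
    ultimately show ?thesis by (simp add: covers_u_def covers_s_def inj_image_subset_iff)
  qed
  moreover have "E = rev ` rev ` E" for E :: "'a list set" by (simp add: image_image)
  ultimately show ?thesis by (metis (no_types, lifting) image_iff set_eqI)
qed

lemma m_u_reflect:
  "m_u (reflect ` X) (\<phi> \<circ> reflect) (reflect x) (reflect ` Z) = m_s X \<phi> x Z"
proof -
  have "(\<Sum>\<^sub>\<infinity>u\<in>rev ` E. f u) = (\<Sum>\<^sub>\<infinity>u\<in>E. f (rev u))" for E :: "'a list set" and f :: "'a list \<Rightarrow> ennreal"
    by (simp add: infsum_reindex o_def)
  then show ?thesis
    by (simp add: m_u_def m_s_def covers_u_reflect image_image Phi_u_reflect pressure_reflect)
qed

lemma bounded_subshift_reflect: "bounded_subshift A (reflect ` X) (\<phi> \<circ> reflect) B"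
proof
  show "finite A" by (rule finite_alphabet)
  show "y i \<in> A" if "y \<in> reflect ` X" for y i
    using that letter_in by (auto simp: reflect_def)
  show "\<bar>(\<phi> \<circ> reflect) y\<bar> \<le> B" if "y \<in> reflect ` X" for y
    using that bounded by auto
  show "shift ` reflect ` X = reflect ` X"
  proof (intro equalityI subsetI)
    fix y assume "y \<in> shift ` reflect ` X"
    then obtain z where "z \<in> X" "y = reflect (inv shift z)" by (auto simp: shift_reflect)
    then show "y \<in> reflect ` X" using translate_diff_in[of z 1] by (simp add: inv_shift)
  next
    fix y assume "y \<in> reflect ` X"
    then obtain z where z: "z \<in> X" "y = reflect z" by blast
    \<comment> \<open>Reflection conjugates the shift to its inverse, so the preimage of
      \<open>reflect z\<close> comes from shifting z forward.\<close>
    then have "y = shift (reflect (shift z))" by (simp add: shift_def reflect_def)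
    then show "y \<in> shift ` reflect ` X" using z shift_image by blast
  qed
  let ?T = "product_topology (\<lambda>_. discrete_topology A) (UNIV :: int set)"
  have "continuous_map ?T ?T reflect"
    unfolding continuous_map_componentwise_UNIV reflect_def
    by (auto intro: continuous_map_product_projection)
  then show "compactin ?T (reflect ` X)" using compact by (rule image_compactin[rotated])
qed

end

theorem theorem1p20:
  fixes A :: "'a set" and X :: "(int \<Rightarrow> 'a) set" and \<phi> :: "(int \<Rightarrow> 'a) \<Rightarrow> real"
    and x :: "int \<Rightarrow> 'a" and w :: "'a list" and n :: nat
  assumes "finite A"
    and "two_sided_shift_space A X"
    and "continuous_potential X \<phi>"
    and "x \<in> X"
    and "n \<ge> 1"
    and "w \<in> lang X n"
  shows
    "(Wu X x \<inter> cyl_fwd X w \<noteq> {} \<longrightarrow>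
        (\<Sum>a\<in>A. at_ext_u X (Q_upper_u X \<phi>) (concat_u x w a))
            / (exp_ereal (V_u X \<phi> x w) * Q_upper X \<phi>)
          \<le> m_u X \<phi> x (Wu X x \<inter> cyl_fwd X w)
            / exp_ereal (Phi_u X \<phi> x w - ereal (real n * pressure X \<phi>)) \<and>
        m_u X \<phi> x (Wu X x \<inter> cyl_fwd X w)
            / exp_ereal (Phi_u X \<phi> x w - ereal (real n * pressure X \<phi>))
          \<le> (\<Sum>a\<in>A. at_ext_u X (Q_lower_u X \<phi>) (concat_u x w a))) \<and>
     (Ws X x \<inter> cyl_bwd X w \<noteq> {} \<longrightarrow>
        (\<Sum>a\<in>A. at_ext_s X (Q_upper_s X \<phi>) (concat_s a w x))
            / (exp_ereal (V_s X \<phi> x w) * Q_upper X \<phi>)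
          \<le> m_s X \<phi> x (Ws X x \<inter> cyl_bwd X w)
            / exp_ereal (Phi_s X \<phi> x w - ereal (real n * pressure X \<phi>)) \<and>
        m_s X \<phi> x (Ws X x \<inter> cyl_bwd X w)
            / exp_ereal (Phi_s X \<phi> x w - ereal (real n * pressure X \<phi>))
          \<le> (\<Sum>a\<in>A. at_ext_s X (Q_lower_s X \<phi>) (concat_s a w x)))"
proof -
  obtain B where "bounded_subshift A X \<phi> B"
    using assms bounded_subshift_exists by blast
  then interpret bounded_subshift A X \<phi> B .
  \<comment> \<open>Applied to the reflected point and \<open>rev w\<close>, the unstable bounds of
    this instance become the stable bounds for x and w.\<close>
  interpret R: bounded_subshift A "reflect ` X" "\<phi> \<circ> reflect" B
    by (rule bounded_subshift_reflect)
  have len: "length w = n" and w: "w \<noteq> []" "rev w \<noteq> []"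
    using assms by (auto simp: lang_def)
  have cost: "exp_ereal (Phi_u X \<phi> x w - ereal (real n * pressure X \<phi>)) = cost x w"
    using exp_ereal_Phi_u len by metis
  have "exp_ereal (Phi_s X \<phi> x w - ereal (real n * pressure X \<phi>)) = R.cost (reflect x) (rev w)"
    using R.exp_ereal_Phi_u[of "reflect x" "rev w"] by (simp add: Phi_u_reflect pressure_reflect len)
  then show ?thesis
    using m_u_lower_bound[OF _ w(1)] m_u_upper_bound[OF _ w(1)]
      R.m_u_lower_bound[OF _ w(2), of "reflect x"] R.m_u_upper_bound[OF _ w(2), of "reflect x"]
    by (simp add: cost at_ext_u_Q_upper at_ext_u_Q_lower at_ext_s_Q_upper at_ext_s_Q_lower
        leaf_cyl_reflect m_u_reflect V_u_reflect Q_upper_reflect concat_u_reflect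
        Q_upper_u_reflect Q_lower_u_reflect)
qed

end
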